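(* Let $R$ be a ring, $M$ an $R$-module, $S\subseteq S'$ two saturated multiplicatively closed subsets of $R$, and $T=S^{-1}S'=\{s'/s : s'\in S', s\in S\}\subseteq R_S$. Suppose that $S$ splits $M$ and that $S'\setminus \mathrm{Ann}(M)$ (a subset of the $R$-module $R$) is compactly $S$-atomic. Let $\alpha\in\{\text{irreducible, strongly irreducible, very strongly irreducible}\}$ and $\beta\in\{\text{primitive, strongly primitive, very strongly primitive}\}$. Then the following hold. (1) If $M$ is $(\alpha,\beta)$-$S'$-atomic, then $M$ is $(\alpha,\text{very strongly primitive})$-$S$-atomic. (2) Assume that $S\cap Z(M)=S\cap Z(R)=\emptyset$. Then $M$ is $(\alpha,\beta)$-$S'$-atomic if and only if $M$ is $(\alpha,\text{primitive})$-$S$-atomic and the $R_S$-module $M_S$ is $(\alpha,\beta)$-$T$-atomic.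
   Context: All rings are commutative with identity and all modules are unitary and nonzero. $U(R)$ is the set of units of $R$. For $N\subseteq M$, $Z(N)=\{r\in R : \exists\, 0\neq m\in N,\ rm=0\}$ and $\mathrm{Ann}(N)=\{r\in R: rN=0\}$. A multiplicatively closed subset $S$ of $R$ (containing $1$) is saturated if $xy\in S$ implies $x,y\in S$; $S$ may contain $0$, which means $S=R$. $R_S$, $M_S$ denote localizations at $S$; $T$ is a saturated multiplicatively closed subset of $R_S$. The following notions are defined for any ring $R$, $R$-module $M$ and saturated multiplicatively closed $S\subseteq R$ (and applied also to other triples such as $(R,M,S')$ and $(R_S,M_S,T)$). For $m,n\in M$: $m\sim^S n$ if there are $s,s'\in S$ with $m=sn$, $n=s'm$; $m\approx^S n$ if $m=un$ for some $u\in U(R)\cap S$; $m\cong^S n$ if $m\sim^S n$ and either $m=n=0$ or $m=sn$ with $s\in S$ implies $s\in U(R)$. When $S=R$ the superscript/prefix is dropped. An element $m\in M$ is $S$-primitive (resp. $S$-strongly primitive, $S$-very strongly primitive) if $m=sn$ with $s\in S$, $n\in M$ implies $n\sim^S m$ (resp. $n\approx^S m$, $n\cong^S m$). A nonunit $a\in R$ is irreducible (resp. strongly irreducible, very strongly irreducible) if $a=bc$ with $b,c\in R$ implies $a\sim b$ or $a\sim c$ (resp. $a\approx b$ or $a\approx c$; $a\cong b$ or $a\cong c$), these relations being taken in the $R$-module $R$ with $S=R$. An $(\alpha,\beta)$-$S$-factorization of $m\in M$ is an equation $m=s_1\cdots s_kn$ with $k\ge 0$, each $s_i$ a nonunit in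 $S$ that is $\alpha$ (in $R$), and $n\in M$ that is $S$-$\beta$. $M$ is $(\alpha,\beta)$-$S$-atomic if every nonzero element of $M$ has an $(\alpha,\beta)$-$S$-factorization. A compact $S$-atomic factorization of $m\in M$ is an equation $m=sn$ with $s\in S$ and $n\in M$ $S$-primitive. A subset $E\subseteq M$ is compactly $S$-atomic if every nonzero element of $E$ has a compact $S$-atomic factorization; $E$ is semi-$S$-factorable if moreover for every $0\neq m\in E$ and compact $S$-atomic factorizations $m=sn=s'n'$ one has $s\sim s'$. $S$ splits $E$ if (i) $E$ is semi-$S$-factorable, and (ii) for every $S$-primitive $r\in R$ (in the $R$-module $R$) and every $S$-primitive $m\in M$ with $0\neq rm\in E$, the element $rm$ is $S$-primitive. *)

theory Defs
  imports "HOL-Algebra.Module"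
begin

section \<open>Saturated multiplicatively closed sets, annihilators, zero divisors\<close>

text \<open>A set \<open>S\<close> containing zero is allowed; saturation then forces \<open>S = carrier R\<close>.\<close>

definition saturated_mult_closed :: "('a, 'm) ring_scheme \<Rightarrow> 'a set \<Rightarrow> bool" where
  "saturated_mult_closed R S \<longleftrightarrow> submonoid S R \<and>
     (\<forall>x \<in> carrier R. \<forall>y \<in> carrier R. x \<otimes>\<^bsub>R\<^esub> y \<in> S \<longrightarrow> x \<in> S \<and> y \<in> S)"

definition ring_module :: "('a, 'm) ring_scheme \<Rightarrow> ('a, 'a) module" where
  "ring_module R = \<lparr>carrier = carrier R, mult = mult R, one = one R, zero = zero R,
     add = add R, smult = mult R\<rparr>"

definition zero_divs :: "('a, 'm) ring_scheme \<Rightarrow> ('a, 'b, 'n) module_scheme \<Rightarrow> 'a set" where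
  "zero_divs R M = {r \<in> carrier R. \<exists>x \<in> carrier M. x \<noteq> \<zero>\<^bsub>M\<^esub> \<and> r \<odot>\<^bsub>M\<^esub> x = \<zero>\<^bsub>M\<^esub>}"

definition annihilator :: "('a, 'm) ring_scheme \<Rightarrow> ('a, 'b, 'n) module_scheme \<Rightarrow> 'a set" where
  "annihilator R M = {r \<in> carrier R. \<forall>x \<in> carrier M. r \<odot>\<^bsub>M\<^esub> x = \<zero>\<^bsub>M\<^esub>}"


section \<open>Associate relations, primitive and irreducible elements\<close>

definition S_assoc ::
  "('a, 'm) ring_scheme \<Rightarrow> ('a, 'b, 'n) module_scheme \<Rightarrow> 'a set \<Rightarrow> 'b \<Rightarrow> 'b \<Rightarrow> bool" where
  "S_assoc R M S x y \<longleftrightarrow> (\<exists>s \<in> S. \<exists>s' \<in> S. x = s \<odot>\<^bsub>M\<^esub> y \<and> y = s' \<odot>\<^bsub>M\<^esub> x)"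

definition S_strong_assoc ::
  "('a, 'm) ring_scheme \<Rightarrow> ('a, 'b, 'n) module_scheme \<Rightarrow> 'a set \<Rightarrow> 'b \<Rightarrow> 'b \<Rightarrow> bool" where
  "S_strong_assoc R M S x y \<longleftrightarrow> (\<exists>u \<in> Units R \<inter> S. x = u \<odot>\<^bsub>M\<^esub> y)"

definition S_very_strong_assoc ::
  "('a, 'm) ring_scheme \<Rightarrow> ('a, 'b, 'n) module_scheme \<Rightarrow> 'a set \<Rightarrow> 'b \<Rightarrow> 'b \<Rightarrow> bool" where
  "S_very_strong_assoc R M S x y \<longleftrightarrow> S_assoc R M S x y \<and>
     (x = \<zero>\<^bsub>M\<^esub> \<and> y = \<zero>\<^bsub>M\<^esub> \<or> (\<forall>s \<in> S. x = s \<odot>\<^bsub>M\<^esub> y \<longrightarrow> s \<in> Units R))"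

datatype primitive_type = Primitive | Strongly_Primitive | Very_Strongly_Primitive

datatype irreducible_type = Irreducible | Strongly_Irreducible | Very_Strongly_Irreducible

text \<open>The type selects one of the three relations; an element \<open>x\<close> is \<open>S\<close>-primitive of the given
  type when every \<open>y\<close> with \<open>x = s y\<close>, \<open>s \<in> S\<close>, is related to \<open>x\<close>, in the order stated.\<close>

fun primitive_rel :: "primitive_type \<Rightarrow> ('a, 'm) ring_scheme \<Rightarrow> ('a, 'b, 'n) module_scheme \<Rightarrow>
    'a set \<Rightarrow> 'b \<Rightarrow> 'b \<Rightarrow> bool" where
  "primitive_rel Primitive R M S = S_assoc R M S"
| "primitive_rel Strongly_Primitive R M S = S_strong_assoc R M S"
| "primitive_rel Very_Strongly_Primitive R M S = S_very_strong_assoc R M S"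

definition S_primitive_of :: "primitive_type \<Rightarrow> ('a, 'm) ring_scheme \<Rightarrow>
    ('a, 'b, 'n) module_scheme \<Rightarrow> 'a set \<Rightarrow> 'b \<Rightarrow> bool" where
  "S_primitive_of \<beta> R M S x \<longleftrightarrow> x \<in> carrier M \<and>
     (\<forall>s \<in> S. \<forall>y \<in> carrier M. x = s \<odot>\<^bsub>M\<^esub> y \<longrightarrow> primitive_rel \<beta> R M S y x)"

abbreviation S_primitive ::
  "('a, 'm) ring_scheme \<Rightarrow> ('a, 'b, 'n) module_scheme \<Rightarrow> 'a set \<Rightarrow> 'b \<Rightarrow> bool" where
  "S_primitive \<equiv> S_primitive_of Primitive"

fun irreducible_rel ::
  "irreducible_type \<Rightarrow> ('a, 'm) ring_scheme \<Rightarrow> 'a \<Rightarrow> 'a \<Rightarrow> bool" where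
  "irreducible_rel Irreducible R = S_assoc R (ring_module R) (carrier R)"
| "irreducible_rel Strongly_Irreducible R = S_strong_assoc R (ring_module R) (carrier R)"
| "irreducible_rel Very_Strongly_Irreducible R = S_very_strong_assoc R (ring_module R) (carrier R)"

text \<open>In rings with zero divisors these notions differ from the library's \<open>irreducible\<close> predicate
  for monoids, which is based on proper divisibility; zero may be irreducible here.\<close>

definition irreducible_of :: "irreducible_type \<Rightarrow> ('a, 'm) ring_scheme \<Rightarrow> 'a \<Rightarrow> bool" where
  "irreducible_of \<alpha> R a \<longleftrightarrow> a \<in> carrier R \<and> a \<notin> Units R \<and>
     (\<forall>b \<in> carrier R. \<forall>c \<in> carrier R. a = b \<otimes>\<^bsub>R\<^esub> c \<longrightarrow>
        irreducible_rel \<alpha> R a b \<or> irreducible_rel \<alpha> R a c)"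


section \<open>Factorizations\<close>

definition S_factorization :: "irreducible_type \<Rightarrow> primitive_type \<Rightarrow> ('a, 'm) ring_scheme \<Rightarrow>
    ('a, 'b, 'n) module_scheme \<Rightarrow> 'a set \<Rightarrow> 'b \<Rightarrow> 'a list \<Rightarrow> 'b \<Rightarrow> bool" where
  "S_factorization \<alpha> \<beta> R M S x ss y \<longleftrightarrow>
     (\<forall>s \<in> set ss. s \<in> S \<and> s \<notin> Units R \<and> irreducible_of \<alpha> R s) \<and>
     S_primitive_of \<beta> R M S y \<and>
     x = foldr (\<otimes>\<^bsub>R\<^esub>) ss \<one>\<^bsub>R\<^esub> \<odot>\<^bsub>M\<^esub> y"

definition S_atomic :: "irreducible_type \<Rightarrow> primitive_type \<Rightarrow> ('a, 'm) ring_scheme \<Rightarrow>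
    ('a, 'b, 'n) module_scheme \<Rightarrow> 'a set \<Rightarrow> bool" where
  "S_atomic \<alpha> \<beta> R M S \<longleftrightarrow>
     (\<forall>x \<in> carrier M. x \<noteq> \<zero>\<^bsub>M\<^esub> \<longrightarrow> (\<exists>ss y. S_factorization \<alpha> \<beta> R M S x ss y))"

definition compact_S_factorization :: "('a, 'm) ring_scheme \<Rightarrow> ('a, 'b, 'n) module_scheme \<Rightarrow>
    'a set \<Rightarrow> 'b \<Rightarrow> 'a \<Rightarrow> 'b \<Rightarrow> bool" where
  "compact_S_factorization R M S x s y \<longleftrightarrow> s \<in> S \<and> S_primitive R M S y \<and> x = s \<odot>\<^bsub>M\<^esub> y"

definition compactly_S_atomic ::
  "('a, 'm) ring_scheme \<Rightarrow> ('a, 'b, 'n) module_scheme \<Rightarrow> 'a set \<Rightarrow> 'b set \<Rightarrow> bool" where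
  "compactly_S_atomic R M S E \<longleftrightarrow>
     (\<forall>x \<in> E. x \<noteq> \<zero>\<^bsub>M\<^esub> \<longrightarrow> (\<exists>s y. compact_S_factorization R M S x s y))"

definition semi_S_factorable ::
  "('a, 'm) ring_scheme \<Rightarrow> ('a, 'b, 'n) module_scheme \<Rightarrow> 'a set \<Rightarrow> 'b set \<Rightarrow> bool" where
  "semi_S_factorable R M S E \<longleftrightarrow> compactly_S_atomic R M S E \<and>
     (\<forall>x \<in> E. x \<noteq> \<zero>\<^bsub>M\<^esub> \<longrightarrow> (\<forall>s y s' y'.
        compact_S_factorization R M S x s y \<longrightarrow> compact_S_factorization R M S x s' y' \<longrightarrow>
        S_assoc R (ring_module R) (carrier R) s s'))"

definition splits ::
  "('a, 'm) ring_scheme \<Rightarrow> ('a, 'b, 'n) module_scheme \<Rightarrow> 'a set \<Rightarrow> 'b set \<Rightarrow> bool" where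
  "splits R M S E \<longleftrightarrow> semi_S_factorable R M S E \<and>
     (\<forall>r x. S_primitive R (ring_module R) S r \<longrightarrow> S_primitive R M S x \<longrightarrow>
        r \<odot>\<^bsub>M\<^esub> x \<in> E \<longrightarrow> r \<odot>\<^bsub>M\<^esub> x \<noteq> \<zero>\<^bsub>M\<^esub> \<longrightarrow> S_primitive R M S (r \<odot>\<^bsub>M\<^esub> x))"


section \<open>Localization\<close>

text \<open>The fraction \<open>x / s\<close> is the class of the pair \<open>(x, s)\<close>; the factor \<open>u\<close> below is needed since
  \<open>S\<close> may contain zero divisors. Operations on fractions are defined by uniting over all
  representatives, as usual for quotients; that they do not depend on the representatives is shown
  afterwards.\<close>

definition fraction_rel ::
  "('a, 'm) ring_scheme \<Rightarrow> ('a, 'b, 'n) module_scheme \<Rightarrow> 'a set \<Rightarrow> (('b \<times> 'a) \<times> ('b \<times> 'a)) set" where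
  "fraction_rel R M S = {((x, s), (y, t)). x \<in> carrier M \<and> y \<in> carrier M \<and> s \<in> S \<and> t \<in> S \<and>
     (\<exists>u \<in> S. u \<odot>\<^bsub>M\<^esub> (t \<odot>\<^bsub>M\<^esub> x) = u \<odot>\<^bsub>M\<^esub> (s \<odot>\<^bsub>M\<^esub> y))}"

definition fraction ::
  "('a, 'm) ring_scheme \<Rightarrow> ('a, 'b, 'n) module_scheme \<Rightarrow> 'a set \<Rightarrow> 'b \<Rightarrow> 'a \<Rightarrow> ('b \<times> 'a) set" where
  "fraction R M S x s = fraction_rel R M S `` {(x, s)}"

definition loc_ring :: "('a, 'm) ring_scheme \<Rightarrow> 'a set \<Rightarrow> ('a \<times> 'a) set ring" where
  "loc_ring R S =
     \<lparr>carrier = (carrier R \<times> S) // fraction_rel R (ring_module R) S,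
      mult = (\<lambda>A B. \<Union>(a, s) \<in> A. \<Union>(b, t) \<in> B.
        fraction R (ring_module R) S (a \<otimes>\<^bsub>R\<^esub> b) (s \<otimes>\<^bsub>R\<^esub> t)),
      one = fraction R (ring_module R) S \<one>\<^bsub>R\<^esub> \<one>\<^bsub>R\<^esub>,
      zero = fraction R (ring_module R) S \<zero>\<^bsub>R\<^esub> \<one>\<^bsub>R\<^esub>,
      add = (\<lambda>A B. \<Union>(a, s) \<in> A. \<Union>(b, t) \<in> B.
        fraction R (ring_module R) S ((t \<otimes>\<^bsub>R\<^esub> a) \<oplus>\<^bsub>R\<^esub> (s \<otimes>\<^bsub>R\<^esub> b)) (s \<otimes>\<^bsub>R\<^esub> t))\<rparr>"

text \<open>The fields \<^const>\<open>mult\<close> and \<^const>\<open>one\<close> play no role in a module.\<close>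

definition loc_module :: "('a, 'm) ring_scheme \<Rightarrow> ('a, 'b, 'n) module_scheme \<Rightarrow> 'a set \<Rightarrow>
    (('a \<times> 'a) set, ('b \<times> 'a) set) module" where
  "loc_module R M S =
     \<lparr>carrier = (carrier M \<times> S) // fraction_rel R M S,
      mult = undefined,
      one = undefined,
      zero = fraction R M S \<zero>\<^bsub>M\<^esub> \<one>\<^bsub>R\<^esub>,
      add = (\<lambda>X Y. \<Union>(x, s) \<in> X. \<Union>(y, t) \<in> Y.
        fraction R M S ((t \<odot>\<^bsub>M\<^esub> x) \<oplus>\<^bsub>M\<^esub> (s \<odot>\<^bsub>M\<^esub> y)) (s \<otimes>\<^bsub>R\<^esub> t)),
      smult = (\<lambda>A X. \<Union>(a, s) \<in> A. \<Union>(x, t) \<in> X. fraction R M S (a \<odot>\<^bsub>M\<^esub> x) (s \<otimes>\<^bsub>R\<^esub> t))\<rparr>"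

definition loc_set :: "('a, 'm) ring_scheme \<Rightarrow> 'a set \<Rightarrow> 'a set \<Rightarrow> ('a \<times> 'a) set set" where
  "loc_set R S S' = {fraction R (ring_module R) S s' s | s' s. s' \<in> S' \<and> s \<in> S}"

lemma abelian_group_cong:
  assumes "abelian_group G" "carrier H = carrier G" "add H = add G" "zero H = zero G"
  shows "abelian_group H"
proof -
  interpret abelian_group G by fact
  show ?thesis
  proof (rule abelian_groupI)
    show "\<exists>y \<in> carrier H. y \<oplus>\<^bsub>H\<^esub> x = \<zero>\<^bsub>H\<^esub>" if "x \<in> carrier H" for x
      using that l_neg[of x] a_inv_closed[of x] unfolding assms(2-4) by blast
  qed (simp_all add: assms(2-4) a_ac)
qed

context module
begin

lemma ring_module_module: "module R (ring_module R)"
proof (rule moduleI)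
  show "cring R" by (rule R.is_cring)
  show "abelian_group (ring_module R)"
    by (rule abelian_group_cong[OF R.abelian_group_axioms]) (simp_all add: ring_module_def)
qed (auto simp: ring_module_def R.m_assoc R.l_distr R.r_distr)

lemma mem_fraction:
  "(y, t) \<in> fraction R M S x s \<longleftrightarrow> x \<in> carrier M \<and> y \<in> carrier M \<and> s \<in> S \<and> t \<in> S \<and>
     (\<exists>u \<in> S. u \<odot>\<^bsub>M\<^esub> (t \<odot>\<^bsub>M\<^esub> x) = u \<odot>\<^bsub>M\<^esub> (s \<odot>\<^bsub>M\<^esub> y))"
  by (simp add: fraction_def fraction_rel_def)

lemma equiv_fraction_rel:
  assumes "submonoid S R"
  shows "equiv (carrier M \<times> S) (fraction_rel R M S)"
proof -
  interpret submonoid S R by fact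
  note [simp] = smult_assoc1 [symmetric]
  have trans: "\<exists>w \<in> S. (w \<otimes> r) \<odot>\<^bsub>M\<^esub> x = (w \<otimes> s) \<odot>\<^bsub>M\<^esub> z"
    if "x \<in> carrier M" "y \<in> carrier M" "z \<in> carrier M" "s \<in> S" "t \<in> S" "r \<in> S" "u \<in> S" "v \<in> S"
      and xy: "(u \<otimes> t) \<odot>\<^bsub>M\<^esub> x = (u \<otimes> s) \<odot>\<^bsub>M\<^esub> y"
      and yz: "(v \<otimes> r) \<odot>\<^bsub>M\<^esub> y = (v \<otimes> t) \<odot>\<^bsub>M\<^esub> z" for x y z s t r u v
  proof (rule bexI[of _ "u \<otimes> v \<otimes> t"])
    have "(u \<otimes> v \<otimes> t \<otimes> r) \<odot>\<^bsub>M\<^esub> x = (v \<otimes> r) \<odot>\<^bsub>M\<^esub> ((u \<otimes> t) \<odot>\<^bsub>M\<^esub> x)"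
      using that(1-8) by (simp add: R.m_ac)
    also have "\<dots> = (u \<otimes> s) \<odot>\<^bsub>M\<^esub> ((v \<otimes> r) \<odot>\<^bsub>M\<^esub> y)"
      unfolding xy using that(1-8) by (simp add: R.m_ac)
    also have "\<dots> = (u \<otimes> v \<otimes> t \<otimes> s) \<odot>\<^bsub>M\<^esub> z"
      unfolding yz using that(1-8) by (simp add: R.m_ac)
    finally show "(u \<otimes> v \<otimes> t \<otimes> r) \<odot>\<^bsub>M\<^esub> x = (u \<otimes> v \<otimes> t \<otimes> s) \<odot>\<^bsub>M\<^esub> z" .
  qed (use that in auto)
  show ?thesis
  proof (rule equivI)
    show "fraction_rel R M S \<subseteq> (carrier M \<times> S) \<times> (carrier M \<times> S)"
      by (auto simp: fraction_rel_def)
    show "refl_on (carrier M \<times> S) (fraction_rel R M S)"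
      by (auto simp: fraction_rel_def refl_on_def)
    show "sym (fraction_rel R M S)"
      by (rule symI) (auto simp: fraction_rel_def, metis)
    show "trans (fraction_rel R M S)"
      by (rule transI) (auto simp: fraction_rel_def intro: trans)
  qed
qed

lemma fraction_eq_iff:
  assumes "submonoid S R" "x \<in> carrier M" "y \<in> carrier M" "s \<in> S" "t \<in> S"
  shows "fraction R M S x s = fraction R M S y t \<longleftrightarrow>
    (\<exists>u \<in> S. u \<odot>\<^bsub>M\<^esub> (t \<odot>\<^bsub>M\<^esub> x) = u \<odot>\<^bsub>M\<^esub> (s \<odot>\<^bsub>M\<^esub> y))"
  using assms eq_equiv_class_iff[OF equiv_fraction_rel[OF assms(1)], of "(x, s)" "(y, t)"]
  by (simp add: fraction_def) (simp add: fraction_rel_def)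

text \<open>Every operation on fractions is well-defined as soon as it respects equality of fractions.\<close>

lemma UN_fraction:
  assumes S: "submonoid S R" and N: "module R N"
    and mem: "x \<in> carrier M" "s \<in> S" "y \<in> carrier N" "t \<in> S"
    and resp: "\<And>x' s' y' t'. \<lbrakk>x' \<in> carrier M; s' \<in> S; y' \<in> carrier N; t' \<in> S;
      fraction R M S x' s' = fraction R M S x s; fraction R N S y' t' = fraction R N S y t\<rbrakk>
      \<Longrightarrow> F x' s' y' t' = F x s y t"
  shows "(\<Union>(x', s') \<in> fraction R M S x s. \<Union>(y', t') \<in> fraction R N S y t. F x' s' y' t') = F x s y t"
proof -
  interpret N: module R N by fact
  have 1: "x' \<in> carrier M \<and> s' \<in> S \<and> fraction R M S x' s' = fraction R M S x s"
    if "(x', s') \<in> fraction R M S x s" for x' s'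
    using that by (auto simp: mem_fraction fraction_eq_iff[OF S]; metis)
  have 2: "y' \<in> carrier N \<and> t' \<in> S \<and> fraction R N S y' t' = fraction R N S y t"
    if "(y', t') \<in> fraction R N S y t" for y' t'
    using that by (auto simp: N.mem_fraction N.fraction_eq_iff[OF S]; metis)
  have ne: "fraction R M S x s \<noteq> {}" "fraction R N S y t \<noteq> {}"
    using mem submonoid.one_closed[OF S] mem_fraction[of x s S x s] N.mem_fraction[of y t S y t]
    by blast+
  have inner: "(\<Union>(y', t') \<in> fraction R N S y t. F x' s' y' t') = F x s y t"
    if "(x', s') \<in> fraction R M S x s" for x' s'
  proof (rule SUP_eq_const)
    fix p assume "p \<in> fraction R N S y t"
    then show "(case p of (y', t') \<Rightarrow> F x' s' y' t') = F x s y t"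
      using 1[OF that] 2 resp by (cases p) simp
  qed (rule ne)
  show ?thesis
  proof (rule SUP_eq_const)
    fix p assume "p \<in> fraction R M S x s"
    then show "(case p of (x', s') \<Rightarrow> \<Union>(y', t') \<in> fraction R N S y t. F x' s' y' t') =
        F x s y t"
      using inner by (cases p) simp
  qed (rule ne)
qed

lemma loc_module_carrier:
  "carrier (loc_module R M S) = {fraction R M S x s | x s. x \<in> carrier M \<and> s \<in> S}"
  by (auto simp: loc_module_def quotient_def fraction_def)

lemma fraction_closed:
  "x \<in> carrier M \<Longrightarrow> s \<in> S \<Longrightarrow> fraction R M S x s \<in> carrier (loc_module R M S)"
  unfolding loc_module_carrier by blast

lemma loc_module_add:
  assumes S: "submonoid S R" and mem: "x \<in> carrier M" "s \<in> S" "y \<in> carrier M" "t \<in> S"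
  shows "fraction R M S x s \<oplus>\<^bsub>loc_module R M S\<^esub> fraction R M S y t =
    fraction R M S ((t \<odot>\<^bsub>M\<^esub> x) \<oplus>\<^bsub>M\<^esub> (s \<odot>\<^bsub>M\<^esub> y)) (s \<otimes> t)"
proof -
  interpret submonoid S R by fact
  have "fraction R M S ((t' \<odot>\<^bsub>M\<^esub> x') \<oplus>\<^bsub>M\<^esub> (s' \<odot>\<^bsub>M\<^esub> y')) (s' \<otimes> t') =
      fraction R M S ((t \<odot>\<^bsub>M\<^esub> x) \<oplus>\<^bsub>M\<^esub> (s \<odot>\<^bsub>M\<^esub> y)) (s \<otimes> t)"
    if mem': "x' \<in> carrier M" "s' \<in> S" "y' \<in> carrier M" "t' \<in> S"
      and eqs: "fraction R M S x' s' = fraction R M S x s" "fraction R M S y' t' = fraction R M S y t" for x' s' y' t'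
  proof -
    obtain u v where uv: "u \<in> S" "v \<in> S"
      and eq: "(u \<otimes> s) \<odot>\<^bsub>M\<^esub> x' = (u \<otimes> s') \<odot>\<^bsub>M\<^esub> x" "(v \<otimes> t) \<odot>\<^bsub>M\<^esub> y' = (v \<otimes> t') \<odot>\<^bsub>M\<^esub> y"
      using eqs mem mem' by (auto simp: fraction_eq_iff[OF S] smult_assoc1)
    note uvm = uv mem mem'
    have "(u \<otimes> v) \<odot>\<^bsub>M\<^esub> ((s \<otimes> t) \<odot>\<^bsub>M\<^esub> ((t' \<odot>\<^bsub>M\<^esub> x') \<oplus>\<^bsub>M\<^esub> (s' \<odot>\<^bsub>M\<^esub> y'))) =
        (v \<otimes> t \<otimes> t') \<odot>\<^bsub>M\<^esub> ((u \<otimes> s) \<odot>\<^bsub>M\<^esub> x') \<oplus>\<^bsub>M\<^esub> (u \<otimes> s \<otimes> s') \<odot>\<^bsub>M\<^esub> ((v \<otimes> t) \<odot>\<^bsub>M\<^esub> y')"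
      using uvm by (simp add: smult_r_distr smult_assoc1 [symmetric] R.m_ac)
    also have "\<dots> = (u \<otimes> v) \<odot>\<^bsub>M\<^esub> ((s' \<otimes> t') \<odot>\<^bsub>M\<^esub> ((t \<odot>\<^bsub>M\<^esub> x) \<oplus>\<^bsub>M\<^esub> (s \<odot>\<^bsub>M\<^esub> y)))"
      unfolding eq using uvm by (simp add: smult_r_distr smult_assoc1 [symmetric] R.m_ac)
    finally show ?thesis
      using uvm by (subst fraction_eq_iff[OF S]) auto
  qed
  then show ?thesis
    using UN_fraction[OF S module_axioms mem,
      of "\<lambda>x s y t. fraction R M S ((t \<odot>\<^bsub>M\<^esub> x) \<oplus>\<^bsub>M\<^esub> (s \<odot>\<^bsub>M\<^esub> y)) (s \<otimes> t)"]
    by (simp add: loc_module_def)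
qed

lemma loc_module_smult:
  assumes S: "submonoid S R" and mem: "a \<in> carrier R" "s \<in> S" "x \<in> carrier M" "t \<in> S"
  shows "fraction R (ring_module R) S a s \<odot>\<^bsub>loc_module R M S\<^esub> fraction R M S x t =
    fraction R M S (a \<odot>\<^bsub>M\<^esub> x) (s \<otimes> t)"
proof -
  interpret submonoid S R by fact
  interpret RM: module R "ring_module R" by (rule ring_module_module)
  have [simp]: "carrier (ring_module R) = carrier R" "smult (ring_module R) = mult R"
    by (simp_all add: ring_module_def)
  have "fraction R M S (a' \<odot>\<^bsub>M\<^esub> x') (s' \<otimes> t') = fraction R M S (a \<odot>\<^bsub>M\<^esub> x) (s \<otimes> t)"
    if mem': "a' \<in> carrier R" "s' \<in> S" "x' \<in> carrier M" "t' \<in> S"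
      and eqs: "fraction R (ring_module R) S a' s' = fraction R (ring_module R) S a s"
        "fraction R M S x' t' = fraction R M S x t" for a' s' x' t'
  proof -
    obtain u v where uv: "u \<in> S" "v \<in> S"
      and eq: "u \<otimes> s \<otimes> a' = u \<otimes> s' \<otimes> a" "(v \<otimes> t) \<odot>\<^bsub>M\<^esub> x' = (v \<otimes> t') \<odot>\<^bsub>M\<^esub> x"
      using eqs mem mem' by (auto simp: fraction_eq_iff[OF S] RM.fraction_eq_iff[OF S] smult_assoc1 R.m_assoc)
    note uvm = uv mem mem'
    have "(u \<otimes> v) \<odot>\<^bsub>M\<^esub> ((s \<otimes> t) \<odot>\<^bsub>M\<^esub> (a' \<odot>\<^bsub>M\<^esub> x')) = (u \<otimes> s \<otimes> a') \<odot>\<^bsub>M\<^esub> ((v \<otimes> t) \<odot>\<^bsub>M\<^esub> x')"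
      using uvm by (simp add: smult_assoc1 [symmetric] R.m_ac)
    also have "\<dots> = (u \<otimes> v) \<odot>\<^bsub>M\<^esub> ((s' \<otimes> t') \<odot>\<^bsub>M\<^esub> (a \<odot>\<^bsub>M\<^esub> x))"
      unfolding eq using uvm by (simp add: smult_assoc1 [symmetric] R.m_ac)
    finally show ?thesis
      using uvm by (subst fraction_eq_iff[OF S]) auto
  qed
  then show ?thesis
    using RM.UN_fraction[OF S module_axioms _ mem(2-4),
      of a "\<lambda>a s x t. fraction R M S (a \<odot>\<^bsub>M\<^esub> x) (s \<otimes> t)"] mem(1)
    by (simp add: loc_module_def)
qed

lemma loc_module_abelian_group:
  assumes S: "submonoid S R"
  shows "abelian_group (loc_module R M S)"
proof -
  interpret submonoid S R by fact
  note [simp] = loc_module_add[OF S]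
  have zero: "\<zero>\<^bsub>loc_module R M S\<^esub> = fraction R M S \<zero>\<^bsub>M\<^esub> \<one>" by (simp add: loc_module_def)
  note simps = smult_r_distr smult_assoc1 [symmetric] R.m_ac M.a_ac
  show ?thesis
  proof (rule abelian_groupI)
    show "\<zero>\<^bsub>loc_module R M S\<^esub> \<in> carrier (loc_module R M S)"
      unfolding zero by (intro fraction_closed M.zero_closed one_closed)
    fix X Y assume "X \<in> carrier (loc_module R M S)" "Y \<in> carrier (loc_module R M S)"
    then obtain x s y t where *: "x \<in> carrier M" "s \<in> S" "y \<in> carrier M" "t \<in> S"
      and [simp]: "X = fraction R M S x s" "Y = fraction R M S y t"
      unfolding loc_module_carrier by blast
    show "X \<oplus>\<^bsub>loc_module R M S\<^esub> Y \<in> carrier (loc_module R M S)"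
      using * by (simp add: fraction_closed)
    show "X \<oplus>\<^bsub>loc_module R M S\<^esub> Y = Y \<oplus>\<^bsub>loc_module R M S\<^esub> X"
      using * by (simp add: simps)
    fix Z assume "Z \<in> carrier (loc_module R M S)"
    then obtain z r where **: "z \<in> carrier M" "r \<in> S" and [simp]: "Z = fraction R M S z r"
      unfolding loc_module_carrier by blast
    show "X \<oplus>\<^bsub>loc_module R M S\<^esub> Y \<oplus>\<^bsub>loc_module R M S\<^esub> Z =
        X \<oplus>\<^bsub>loc_module R M S\<^esub> (Y \<oplus>\<^bsub>loc_module R M S\<^esub> Z)"
      using * ** by (simp add: simps)
  next
    fix X assume "X \<in> carrier (loc_module R M S)"
    then obtain x s where *: "x \<in> carrier M" "s \<in> S" and [simp]: "X = fraction R M S x s"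
      unfolding loc_module_carrier by blast
    show "\<zero>\<^bsub>loc_module R M S\<^esub> \<oplus>\<^bsub>loc_module R M S\<^esub> X = X"
      using * by (simp add: zero)
    have "fraction R M S (\<ominus>\<^bsub>M\<^esub> x) s \<oplus>\<^bsub>loc_module R M S\<^esub> X = \<zero>\<^bsub>loc_module R M S\<^esub>"
      using * by (simp add: zero fraction_eq_iff[OF S] smult_r_minus M.l_neg) blast
    moreover have "fraction R M S (\<ominus>\<^bsub>M\<^esub> x) s \<in> carrier (loc_module R M S)"
      using * by (simp add: fraction_closed)
    ultimately show "\<exists>Y \<in> carrier (loc_module R M S). Y \<oplus>\<^bsub>loc_module R M S\<^esub> X = \<zero>\<^bsub>loc_module R M S\<^esub>"
      by blast
  qed
qed

lemma loc_ring_conv: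
  "carrier (loc_ring R S) = carrier (loc_module R (ring_module R) S)"
  "mult (loc_ring R S) = smult (loc_module R (ring_module R) S)"
  "add (loc_ring R S) = add (loc_module R (ring_module R) S)"
  "zero (loc_ring R S) = zero (loc_module R (ring_module R) S)"
  by (simp_all add: loc_ring_def loc_module_def ring_module_def)

lemma loc_ring_cring:
  assumes S: "submonoid S R"
  shows "cring (loc_ring R S)"
proof -
  interpret submonoid S R by fact
  interpret RM: module R "ring_module R" by (rule ring_module_module)
  have [simp]: "carrier (ring_module R) = carrier R" "smult (ring_module R) = mult R"
    "add (ring_module R) = add R"
    by (simp_all add: ring_module_def)
  note [simp] = RM.loc_module_add[OF S, simplified] RM.loc_module_smult[OF S, simplified]
  note carr = loc_ring_conv(1) RM.loc_module_carrier
  have one: "\<one>\<^bsub>loc_ring R S\<^esub> = fraction R (ring_module R) S \<one> \<one>" by (simp add: loc_ring_def)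
  show ?thesis
  proof (rule cringI)
    show "abelian_group (loc_ring R S)"
      by (rule abelian_group_cong[OF RM.loc_module_abelian_group[OF S]]) (simp_all add: loc_ring_conv)
    show "Group.comm_monoid (loc_ring R S)"
    proof (rule comm_monoidI)
      show "\<one>\<^bsub>loc_ring R S\<^esub> \<in> carrier (loc_ring R S)"
        unfolding one carr using R.one_closed submonoid.one_closed[OF S] by fastforce
    next
      fix A B assume "A \<in> carrier (loc_ring R S)" "B \<in> carrier (loc_ring R S)"
      then obtain a s b t where *: "a \<in> carrier R" "s \<in> S" "b \<in> carrier R" "t \<in> S"
        and [simp]: "A = fraction R (ring_module R) S a s" "B = fraction R (ring_module R) S b t"
        unfolding carr by auto
      have "a \<otimes> b \<in> carrier R" "s \<otimes> t \<in> S" using * by auto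
      then show "A \<otimes>\<^bsub>loc_ring R S\<^esub> B \<in> carrier (loc_ring R S)"
        using * unfolding carr by (auto simp: loc_ring_conv)
      show "A \<otimes>\<^bsub>loc_ring R S\<^esub> B = B \<otimes>\<^bsub>loc_ring R S\<^esub> A"
        using * by (simp add: loc_ring_conv R.m_ac)
      fix C assume "C \<in> carrier (loc_ring R S)"
      then obtain c r where **: "c \<in> carrier R" "r \<in> S"
        and [simp]: "C = fraction R (ring_module R) S c r"
        unfolding carr by auto
      show "A \<otimes>\<^bsub>loc_ring R S\<^esub> B \<otimes>\<^bsub>loc_ring R S\<^esub> C = A \<otimes>\<^bsub>loc_ring R S\<^esub> (B \<otimes>\<^bsub>loc_ring R S\<^esub> C)"
        using * ** by (simp add: loc_ring_conv R.m_ac)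
    next
      fix A assume "A \<in> carrier (loc_ring R S)"
      then show "\<one>\<^bsub>loc_ring R S\<^esub> \<otimes>\<^bsub>loc_ring R S\<^esub> A = A"
        unfolding one carr by (auto simp: loc_ring_conv)
    qed
  next
    fix A B C
    assume "A \<in> carrier (loc_ring R S)" "B \<in> carrier (loc_ring R S)" "C \<in> carrier (loc_ring R S)"
    then obtain a s b t c r where *: "a \<in> carrier R" "s \<in> S" "b \<in> carrier R" "t \<in> S" "c \<in> carrier R" "r \<in> S"
      and [simp]: "A = fraction R (ring_module R) S a s" "B = fraction R (ring_module R) S b t"
        "C = fraction R (ring_module R) S c r"
      unfolding carr by auto
    show "(A \<oplus>\<^bsub>loc_ring R S\<^esub> B) \<otimes>\<^bsub>loc_ring R S\<^esub> C =
        A \<otimes>\<^bsub>loc_ring R S\<^esub> C \<oplus>\<^bsub>loc_ring R S\<^esub> B \<otimes>\<^bsub>loc_ring R S\<^esub> C"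
      using * by (simp add: loc_ring_conv RM.fraction_eq_iff[OF S] R.r_distr R.l_distr R.m_ac) blast
  qed
qed

lemma loc_module_module:
  assumes S: "submonoid S R"
  shows "module (loc_ring R S) (loc_module R M S)"
proof -
  interpret submonoid S R by fact
  interpret RM: module R "ring_module R" by (rule ring_module_module)
  have [simp]: "carrier (ring_module R) = carrier R" "smult (ring_module R) = mult R"
    "add (ring_module R) = add R"
    by (simp_all add: ring_module_def)
  note [simp] = RM.loc_module_add[OF S, simplified] RM.loc_module_smult[OF S, simplified]
    loc_module_add[OF S] loc_module_smult[OF S]
  note carr = loc_ring_conv(1) RM.loc_module_carrier
  have one: "\<one>\<^bsub>loc_ring R S\<^esub> = fraction R (ring_module R) S \<one> \<one>" by (simp add: loc_ring_def)
  have eqI: "fraction R M S x s = fraction R M S y t"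
    if "x \<in> carrier M" "y \<in> carrier M" "s \<in> S" "t \<in> S" "t \<odot>\<^bsub>M\<^esub> x = s \<odot>\<^bsub>M\<^esub> y" for x y s t
    using that by (auto simp: fraction_eq_iff[OF S])
  note simps = smult_r_distr smult_l_distr smult_assoc1 [symmetric] R.m_ac
  show ?thesis
  proof (rule moduleI)
    show "cring (loc_ring R S)" by (rule loc_ring_cring[OF S])
    show "abelian_group (loc_module R M S)" by (rule loc_module_abelian_group[OF S])
  next
    fix A B X Y
    assume "A \<in> carrier (loc_ring R S)" "X \<in> carrier (loc_module R M S)"
    then obtain a s x r where *: "a \<in> carrier R" "s \<in> S" "x \<in> carrier M" "r \<in> S"
      and [simp]: "A = fraction R (ring_module R) S a s" "X = fraction R M S x r"
      unfolding carr loc_module_carrier by auto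
    have "a \<odot>\<^bsub>M\<^esub> x \<in> carrier M" "s \<otimes> r \<in> S" using * by auto
    then show "A \<odot>\<^bsub>loc_module R M S\<^esub> X \<in> carrier (loc_module R M S)"
      using * unfolding loc_module_carrier by auto
    { assume "B \<in> carrier (loc_ring R S)"
      then obtain b t where **: "b \<in> carrier R" "t \<in> S"
        and [simp]: "B = fraction R (ring_module R) S b t"
        unfolding carr by auto
      show "(A \<oplus>\<^bsub>loc_ring R S\<^esub> B) \<odot>\<^bsub>loc_module R M S\<^esub> X =
          A \<odot>\<^bsub>loc_module R M S\<^esub> X \<oplus>\<^bsub>loc_module R M S\<^esub> B \<odot>\<^bsub>loc_module R M S\<^esub> X"
        using * ** by (simp add: loc_ring_conv) (rule eqI; simp add: simps)
      show "(A \<otimes>\<^bsub>loc_ring R S\<^esub> B) \<odot>\<^bsub>loc_module R M S\<^esub> X =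
          A \<odot>\<^bsub>loc_module R M S\<^esub> (B \<odot>\<^bsub>loc_module R M S\<^esub> X)"
        using * ** by (simp add: loc_ring_conv simps) }
    { assume "Y \<in> carrier (loc_module R M S)"
      then obtain y t where **: "y \<in> carrier M" "t \<in> S" and [simp]: "Y = fraction R M S y t"
        unfolding loc_module_carrier by auto
      show "A \<odot>\<^bsub>loc_module R M S\<^esub> (X \<oplus>\<^bsub>loc_module R M S\<^esub> Y) =
          A \<odot>\<^bsub>loc_module R M S\<^esub> X \<oplus>\<^bsub>loc_module R M S\<^esub> A \<odot>\<^bsub>loc_module R M S\<^esub> Y"
        using * ** by simp (rule eqI; simp add: simps) }
  next
    fix X assume "X \<in> carrier (loc_module R M S)"
    then show "\<one>\<^bsub>loc_ring R S\<^esub> \<odot>\<^bsub>loc_module R M S\<^esub> X = X"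
      unfolding one loc_module_carrier by auto
  qed
qed

end

end

theory Submission
  imports Defs
begin

text \<open>
  Call \<open>x\<close> \<open>S\<close>-reduced if \<open>x = s y\<close> with \<open>s \<in> S\<close> forces \<open>s\<close> to be a unit. When \<open>S\<close> splits \<open>M\<close>,
  the nonzero \<open>S\<close>-primitive elements of \<open>M\<close> are exactly the nonzero \<open>S\<close>-reduced ones (compare the
  compact factorizations \<open>x = s y = 1 x\<close>), and likewise for elements of \<open>S' - Ann M\<close>. An irreducible
  \<open>a = t r\<close> of the latter set, with \<open>t \<in> S\<close> and \<open>r\<close> reduced, is associated to \<open>t\<close> and then lies in \<open>S\<close>,
  or to \<open>r\<close> and then \<open>t\<close> is a unit and \<open>a\<close> is reduced. Since reduced coefficients preserve reduced
  elements of \<open>M\<close>, an \<open>S'\<close>-factorization becomes an \<open>S\<close>-factorization by collecting the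
  factors outside \<open>S\<close> into the primitive part.

  If \<open>S\<close> consists of regular elements, \<open>v x = d y\<close> with \<open>v, d \<in> S\<close> and \<open>x, y\<close> reduced means that \<open>x\<close> and
  \<open>y\<close> differ by a unit. Hence every equation between fractions of reduced elements descends to an
  equation without denominators, so irreducibility and primitivity of all three types can be
  transferred between a reduced element \<open>x\<close> and any fraction \<open>(d x) / s\<close>.
\<close>

section \<open>Saturated sets and reduced elements\<close>

text \<open>For nonzero \<open>x\<close> this is very strong primitivity, freed of the associate
  relation and therefore easily inherited by divisors. Zero is reduced only when every element of
  \<open>S\<close> is a unit, hence the nonzero side conditions below.\<close>

definition S_reduced ::
  "('a, 'm) ring_scheme \<Rightarrow> ('a, 'b, 'n) module_scheme \<Rightarrow> 'a set \<Rightarrow> 'b \<Rightarrow> bool" where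
  "S_reduced R M S x \<longleftrightarrow> x \<in> carrier M \<and>
     (\<forall>s \<in> S. \<forall>y \<in> carrier M. x = s \<odot>\<^bsub>M\<^esub> y \<longrightarrow> s \<in> Units R)"

text \<open>Each irreducibility relation is a primitivity relation of \<open>R\<close> over itself
  with \<open>carrier R\<close> as the multiplicative set. One descent lemma can then treat
  irreducible and primitive elements alike.\<close>

fun assoc_type :: "irreducible_type \<Rightarrow> primitive_type" where
  "assoc_type Irreducible = Primitive"
| "assoc_type Strongly_Irreducible = Strongly_Primitive"
| "assoc_type Very_Strongly_Irreducible = Very_Strongly_Primitive"

lemma irreducible_rel_conv:
  "irreducible_rel \<alpha> R = primitive_rel (assoc_type \<alpha>) R (ring_module R) (carrier R)"
  by (cases \<alpha>) simp_all

text \<open>The relations see only scalar multiplication and zero. This identifies them on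
  \<open>ring_module (loc_ring R S)\<close> and \<open>loc_module R (ring_module R) S\<close>, which
  are built as different records.\<close>

lemma primitive_rel_cong:
  assumes "smult M = smult N" "\<zero>\<^bsub>M\<^esub> = \<zero>\<^bsub>N\<^esub>"
  shows "primitive_rel \<rho> R M S = primitive_rel \<rho> R N S"
  by (cases \<rho>; intro ext;
      simp add: assms S_assoc_def S_strong_assoc_def S_very_strong_assoc_def)

lemma ring_module_simps [simp]:
  "carrier (ring_module R) = carrier R" "smult (ring_module R) = mult R"
  "\<zero>\<^bsub>ring_module R\<^esub> = \<zero>\<^bsub>R\<^esub>"
  by (simp_all add: ring_module_def)

lemma (in cring) Units_factor:
  assumes "a \<in> carrier R" "b \<in> carrier R" "a \<otimes> b \<in> Units R"
  shows "a \<in> Units R"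
proof -
  let ?c = "b \<otimes> inv (a \<otimes> b)"
  have c: "?c \<in> carrier R"
    using assms Units_inv_closed by blast
  have "a \<otimes> ?c = \<one>"
    using assms Units_r_inv[OF assms(3)] Units_inv_closed[OF assms(3)] by (simp add: m_assoc [symmetric])
  moreover from this have "?c \<otimes> a = \<one>"
    using m_comm[OF assms(1) c] by metis
  ultimately show ?thesis
    using assms(1) c unfolding Units_def by blast
qed

context module
begin

lemma foldr_mult_closed [simp]: "set as \<subseteq> carrier R \<Longrightarrow> foldr (\<otimes>) as \<one> \<in> carrier R"
  by (induction as) auto

lemma foldr_mult_append:
  "set as \<subseteq> carrier R \<Longrightarrow> set bs \<subseteq> carrier R \<Longrightarrow>
     foldr (\<otimes>) (as @ bs) \<one> = foldr (\<otimes>) as \<one> \<otimes> foldr (\<otimes>) bs \<one>"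
  by (induction as) (auto simp: R.m_assoc)

lemma foldr_mult_Cons_smult:
  "a \<in> carrier R \<Longrightarrow> set as \<subseteq> carrier R \<Longrightarrow> x \<in> carrier M \<Longrightarrow>
     foldr (\<otimes>) (a # as) \<one> \<odot>\<^bsub>M\<^esub> x = a \<odot>\<^bsub>M\<^esub> (foldr (\<otimes>) as \<one> \<odot>\<^bsub>M\<^esub> x)"
  by (simp add: smult_assoc1)

end

locale saturated_module = module +
  fixes S
  assumes saturated: "saturated_mult_closed R S"
begin

lemma submonoid_S: "submonoid S R"
  using saturated by (simp add: saturated_mult_closed_def)

lemma S_carrier [simp, intro]: "s \<in> S \<Longrightarrow> s \<in> carrier R"
  using submonoid.subset[OF submonoid_S] by blast

lemma S_one [simp, intro]: "\<one> \<in> S"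
  by (rule submonoid.one_closed[OF submonoid_S])

lemma S_mult [simp, intro]: "s \<in> S \<Longrightarrow> t \<in> S \<Longrightarrow> s \<otimes> t \<in> S"
  by (rule submonoid.m_closed[OF submonoid_S])

lemma S_factor:
  "a \<in> carrier R \<Longrightarrow> b \<in> carrier R \<Longrightarrow> a \<otimes> b \<in> S \<Longrightarrow> a \<in> S \<and> b \<in> S"
  using saturated unfolding saturated_mult_closed_def by blast

lemma S_mult_iff:
  "a \<in> carrier R \<Longrightarrow> b \<in> carrier R \<Longrightarrow> a \<otimes> b \<in> S \<longleftrightarrow> a \<in> S \<and> b \<in> S"
  using S_factor S_mult by blast

lemma Units_S: "u \<in> Units R \<Longrightarrow> u \<in> S"
  using S_factor[of u "inv u"] by (simp add: R.Units_closed)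

lemma foldr_mult_in_S: "set ss \<subseteq> S \<Longrightarrow> foldr (\<otimes>) ss \<one> \<in> S"
  by (induction ss) auto

lemma S_reduced_D:
  "S_reduced R M S x \<Longrightarrow> x = s \<odot>\<^bsub>M\<^esub> y \<Longrightarrow> s \<in> S \<Longrightarrow> y \<in> carrier M \<Longrightarrow> s \<in> Units R"
  by (auto simp: S_reduced_def)

lemma S_reduced_closed: "S_reduced R M S x \<Longrightarrow> x \<in> carrier M"
  by (auto simp: S_reduced_def)

lemma unit_smult_eq_iff:
  assumes "u \<in> Units R" "x \<in> carrier M" "y \<in> carrier M"
  shows "x = u \<odot>\<^bsub>M\<^esub> y \<longleftrightarrow> y = inv u \<odot>\<^bsub>M\<^esub> x"
proof -
  have "u \<odot>\<^bsub>M\<^esub> (inv u \<odot>\<^bsub>M\<^esub> x) = x" "inv u \<odot>\<^bsub>M\<^esub> (u \<odot>\<^bsub>M\<^esub> y) = y"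
    using assms by (simp_all add: smult_assoc1 [symmetric] R.Units_closed)
  then show ?thesis by auto
qed

text \<open>Any \<open>S\<close>-factor of \<open>x\<close> is also an \<open>S\<close>-factor of
  \<open>c x\<close>, where reducedness makes it a unit.\<close>

lemma S_reduced_factor:
  assumes "S_reduced R M S (c \<odot>\<^bsub>M\<^esub> x)" "c \<in> carrier R" "x \<in> carrier M"
  shows "S_reduced R M S x"
  unfolding S_reduced_def
proof (intro conjI ballI impI)
  fix s y assume sy: "s \<in> S" "y \<in> carrier M" "x = s \<odot>\<^bsub>M\<^esub> y"
  have "c \<odot>\<^bsub>M\<^esub> x = s \<odot>\<^bsub>M\<^esub> (c \<odot>\<^bsub>M\<^esub> y)"
    using sy assms by (simp add: smult_assoc1 [symmetric] R.m_comm)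
  then show "s \<in> Units R"
    using S_reduced_D[OF assms(1)] sy assms by auto
qed (rule assms)

text \<open>Since \<open>x\<close> is \<open>inv u\<close> times \<open>u x\<close>, the latter is a
  factor of a reduced element.\<close>

lemma S_reduced_unit:
  assumes "S_reduced R M S x" "u \<in> Units R"
  shows "S_reduced R M S (u \<odot>\<^bsub>M\<^esub> x)"
proof -
  have "x = inv u \<odot>\<^bsub>M\<^esub> (u \<odot>\<^bsub>M\<^esub> x)"
    using assms S_reduced_closed[OF assms(1)] by (simp add: smult_assoc1 [symmetric] R.Units_closed)
  then show ?thesis
    using assms R.Units_closed S_reduced_closed[OF assms(1)] S_reduced_factor[of "inv u" "u \<odot>\<^bsub>M\<^esub> x"] by simp
qed

text \<open>As \<open>s\<close> is a unit, \<open>y = inv s x\<close> gives the two weaker relations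
  at once. The very strong one asks in addition that every \<open>t\<close> with
  \<open>y = t x\<close> be a unit.\<close>

lemma S_reduced_imp_S_primitive_of:
  assumes x: "S_reduced R M S x"
  shows "S_primitive_of \<beta> R M S x"
  unfolding S_primitive_of_def
proof (intro conjI ballI impI)
  show xc: "x \<in> carrier M" using x by (rule S_reduced_closed)
  fix s y assume sy: "s \<in> S" "y \<in> carrier M" "x = s \<odot>\<^bsub>M\<^esub> y"
  have s: "s \<in> Units R" using S_reduced_D[OF x sy(3)] sy by blast
  then have y: "y = inv s \<odot>\<^bsub>M\<^esub> x" using unit_smult_eq_iff xc sy by blast
  have "t \<in> Units R" if t: "t \<in> S" "y = t \<odot>\<^bsub>M\<^esub> x" for t
  proof -
    \<comment> \<open>Substituting \<open>y = t x\<close> into \<open>x = s y\<close> exhibits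
      \<open>t\<close> as an \<open>S\<close>-factor of \<open>x\<close>.\<close>
    have "x = t \<odot>\<^bsub>M\<^esub> (s \<odot>\<^bsub>M\<^esub> x)"
      using sy(1) t xc by (subst sy(3)) (simp add: smult_assoc1 [symmetric] R.m_comm)
    then show ?thesis using S_reduced_D[OF x _ t(1)] sy(1) xc by blast
  qed
  moreover have u: "inv s \<in> Units R" "inv s \<in> S"
    using R.Units_inv_Units[OF s] Units_S by blast+
  moreover have "S_assoc R M S y x"
    unfolding S_assoc_def by (intro bexI conjI, rule y, rule sy(3), rule sy(1), rule u(2))
  moreover have "S_strong_assoc R M S y x"
    unfolding S_strong_assoc_def by (intro bexI IntI, rule y, rule u(1), rule u(2))
  ultimately show "primitive_rel \<beta> R M S y x"
    by (cases \<beta>) (simp_all add: S_very_strong_assoc_def)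
qed

text \<open>Every relation makes \<open>y\<close> an \<open>S\<close>-multiple of \<open>x\<close>;
  the equation \<open>x = s y\<close> under test supplies the other half of
  \<open>S_assoc\<close>.\<close>

lemma S_primitive_of_imp_S_primitive:
  assumes x: "S_primitive_of \<beta> R M S x"
  shows "S_primitive R M S x"
  unfolding S_primitive_of_def
proof (intro conjI ballI impI)
  show xc: "x \<in> carrier M" using x by (simp add: S_primitive_of_def)
  fix s y assume sy: "s \<in> S" "y \<in> carrier M" "x = s \<odot>\<^bsub>M\<^esub> y"
  then have "primitive_rel \<beta> R M S y x" using x by (auto simp: S_primitive_of_def)
  then show "primitive_rel Primitive R M S y x"
    using sy xc by (cases \<beta>) (auto simp: S_assoc_def S_strong_assoc_def S_very_strong_assoc_def)
qed

end

section \<open>Localization at regular elements\<close>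

locale regular_module = saturated_module +
  assumes regular_M: "S \<inter> zero_divs R M = {}"
    and regular_R: "S \<inter> zero_divs R (ring_module R) = {}"
begin

abbreviation frac where "frac x s \<equiv> fraction R M S x s"
abbreviation rfrac where "rfrac a s \<equiv> fraction R (ring_module R) S a s"

lemma smult_eq_zero_iff:
  "s \<in> S \<Longrightarrow> x \<in> carrier M \<Longrightarrow> s \<odot>\<^bsub>M\<^esub> x = \<zero>\<^bsub>M\<^esub> \<longleftrightarrow> x = \<zero>\<^bsub>M\<^esub>"
  using regular_M by (auto simp: zero_divs_def)

lemma smult_cancel:
  assumes "s \<in> S" "x \<in> carrier M" "y \<in> carrier M"
  shows "s \<odot>\<^bsub>M\<^esub> x = s \<odot>\<^bsub>M\<^esub> y \<longleftrightarrow> x = y"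
proof
  assume eq: "s \<odot>\<^bsub>M\<^esub> x = s \<odot>\<^bsub>M\<^esub> y"
  have "s \<odot>\<^bsub>M\<^esub> (x \<ominus>\<^bsub>M\<^esub> y) = \<zero>\<^bsub>M\<^esub>"
    using assms eq by (simp add: M.minus_eq smult_r_distr smult_r_minus M.r_neg)
  then have "x \<ominus>\<^bsub>M\<^esub> y = \<zero>\<^bsub>M\<^esub>"
    using assms smult_eq_zero_iff by simp
  moreover have "x = (x \<ominus>\<^bsub>M\<^esub> y) \<oplus>\<^bsub>M\<^esub> y"
    using assms by (simp add: M.minus_eq M.a_assoc M.l_neg)
  ultimately show "x = y" using assms by simp
qed simp

text \<open>Both regularity assumptions turn into the one on \<open>R\<close>, so the results of
  this locale can be reused for \<open>R\<close> as a module over itself.\<close>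

lemma regular_ring_module: "regular_module R (ring_module R) S"
proof -
  interpret RM: module R "ring_module R" by (rule ring_module_module)
  show ?thesis by unfold_locales (use saturated regular_R in auto)
qed

lemma mult_cancel:
  "s \<in> S \<Longrightarrow> a \<in> carrier R \<Longrightarrow> b \<in> carrier R \<Longrightarrow> s \<otimes> a = s \<otimes> b \<longleftrightarrow> a = b"
  using regular_module.smult_cancel[OF regular_ring_module] by simp

text \<open>The extra factor in the equality of fractions cancels by regularity and leaves plain
  cross-multiplication.\<close>

lemma frac_eq_iff:
  assumes "x \<in> carrier M" "y \<in> carrier M" "s \<in> S" "t \<in> S"
  shows "frac x s = frac y t \<longleftrightarrow> t \<odot>\<^bsub>M\<^esub> x = s \<odot>\<^bsub>M\<^esub> y"
  using assms fraction_eq_iff[OF submonoid_S] smult_cancel by auto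

lemma frac_zero_iff:
  assumes "x \<in> carrier M" "s \<in> S"
  shows "frac x s = \<zero>\<^bsub>loc_module R M S\<^esub> \<longleftrightarrow> x = \<zero>\<^bsub>M\<^esub>"
  using assms by (simp add: loc_module_def frac_eq_iff)

lemmas rfrac_eq_iff = regular_module.frac_eq_iff[OF regular_ring_module, simplified]

lemma smult_frac:
  "a \<in> carrier R \<Longrightarrow> s \<in> S \<Longrightarrow> x \<in> carrier M \<Longrightarrow> t \<in> S \<Longrightarrow>
    rfrac a s \<odot>\<^bsub>loc_module R M S\<^esub> frac x t = frac (a \<odot>\<^bsub>M\<^esub> x) (s \<otimes> t)"
  by (rule loc_module_smult[OF submonoid_S])

lemma mult_rfrac:
  "a \<in> carrier R \<Longrightarrow> s \<in> S \<Longrightarrow> b \<in> carrier R \<Longrightarrow> t \<in> S \<Longrightarrow>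
    rfrac a s \<otimes>\<^bsub>loc_ring R S\<^esub> rfrac b t = rfrac (a \<otimes> b) (s \<otimes> t)"
  using regular_module.smult_frac[OF regular_ring_module] by (simp add: loc_ring_conv)

section \<open>Membership and units in the localized ring\<close>

lemma loc_set_eq: "loc_set R S A = {rfrac a s | a s. a \<in> A \<and> s \<in> S}"
  by (auto simp: loc_set_def)

lemma loc_ring_carrier: "carrier (loc_ring R S) = loc_set R S (carrier R)"
  using module.loc_module_carrier[OF ring_module_module]
  by (auto simp: loc_set_eq loc_ring_conv)

text \<open>Equality with some \<open>b / t\<close>, \<open>b\<close> in \<open>A\<close>, gives
  \<open>t a = s b\<close> in \<open>A\<close>, and saturation drops \<open>t\<close>. Membership
  can thus be read off any representative.\<close>

lemma rfrac_in_loc_set_iff: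
  assumes A: "saturated_mult_closed R A" "S \<subseteq> A" and a: "a \<in> carrier R" "s \<in> S"
  shows "rfrac a s \<in> loc_set R S A \<longleftrightarrow> a \<in> A"
proof
  interpret A: saturated_module R M A by unfold_locales (rule A)
  assume "rfrac a s \<in> loc_set R S A"
  then obtain b t where "b \<in> A" "t \<in> S" "rfrac a s = rfrac b t" by (auto simp: loc_set_eq)
  then have "t \<otimes> a \<in> A" using a A by (auto simp: rfrac_eq_iff)
  then show "a \<in> A" using A.S_factor \<open>t \<in> S\<close> a by blast
qed (use a in \<open>auto simp: loc_set_eq\<close>)

text \<open>An inverse \<open>b / t\<close> gives \<open>a b = s t\<close> in \<open>S\<close>, so
  saturation puts \<open>a\<close> into \<open>S\<close>; conversely \<open>s / a\<close> is an
  inverse.\<close>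

lemma rfrac_Units_iff:
  assumes a: "a \<in> carrier R" "s \<in> S"
  shows "rfrac a s \<in> Units (loc_ring R S) \<longleftrightarrow> a \<in> S"
proof
  have one: "\<one>\<^bsub>loc_ring R S\<^esub> = rfrac \<one> \<one>" by (simp add: loc_ring_def)
  {
    assume "rfrac a s \<in> Units (loc_ring R S)"
    then obtain B where "B \<in> carrier (loc_ring R S)" "rfrac a s \<otimes>\<^bsub>loc_ring R S\<^esub> B = \<one>\<^bsub>loc_ring R S\<^esub>"
      by (auto simp: Units_def)
    then obtain b t where b: "b \<in> carrier R" "t \<in> S" "rfrac (a \<otimes> b) (s \<otimes> t) = rfrac \<one> \<one>"
      using a by (auto simp: loc_ring_carrier loc_set_eq mult_rfrac one)
    then have "a \<otimes> b = s \<otimes> t" using a by (simp add: rfrac_eq_iff)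
    then show "a \<in> S" using S_factor[of a b] a b by auto
  next
    assume aS: "a \<in> S"
    then have "rfrac a s \<in> carrier (loc_ring R S)" "rfrac s a \<in> carrier (loc_ring R S)"
      using a by (auto simp: loc_ring_carrier loc_set_eq)
    moreover have "rfrac a s \<otimes>\<^bsub>loc_ring R S\<^esub> rfrac s a = \<one>\<^bsub>loc_ring R S\<^esub>"
      "rfrac s a \<otimes>\<^bsub>loc_ring R S\<^esub> rfrac a s = \<one>\<^bsub>loc_ring R S\<^esub>"
      using a aS by (simp_all add: mult_rfrac one rfrac_eq_iff R.m_comm)
    ultimately show "rfrac a s \<in> Units (loc_ring R S)" by (auto simp: Units_def)
  }
qed

text \<open>Stated for a general module because it is needed for \<open>M\<close> with \<open>A = S'\<close> and for \<open>R\<close> as a module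
  over itself with \<open>A = R\<close>.\<close>

lemma primitive_rel_frac_iff:
  assumes A: "saturated_mult_closed R A" "S \<subseteq> A"
    and x: "S_reduced R M S x" "x \<noteq> \<zero>\<^bsub>M\<^esub>" and y: "S_reduced R M S y"
    and xy: "\<And>v c. v \<in> S \<Longrightarrow> c \<in> A \<Longrightarrow> v \<odot>\<^bsub>M\<^esub> x = c \<odot>\<^bsub>M\<^esub> y \<Longrightarrow>
      \<exists>c' \<in> A. x = c' \<odot>\<^bsub>M\<^esub> y \<and> c = v \<otimes> c'"
    and yx: "\<And>v c. v \<in> S \<Longrightarrow> c \<in> A \<Longrightarrow> v \<odot>\<^bsub>M\<^esub> y = c \<odot>\<^bsub>M\<^esub> x \<Longrightarrow>
      \<exists>c' \<in> A. y = c' \<odot>\<^bsub>M\<^esub> x \<and> c = v \<otimes> c'"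
    and S: "d \<in> S" "s \<in> S" "e \<in> S" "t \<in> S"
  shows "primitive_rel \<rho> (loc_ring R S) (loc_module R M S) (loc_set R S A)
      (frac (d \<odot>\<^bsub>M\<^esub> x) s) (frac (e \<odot>\<^bsub>M\<^esub> y) t) \<longleftrightarrow> primitive_rel \<rho> R M A x y"
proof -
  interpret A: saturated_module R M A by unfold_locales (rule A)
  note closed = S_reduced_closed[OF x(1)] S_reduced_closed[OF y]
  have SA: "c \<in> A" if "c \<in> S" for c using that A by blast
  let ?T = "loc_set R S A"
  let ?eq = "\<lambda>d s x e t y C. frac (d \<odot>\<^bsub>M\<^esub> x) s = C \<odot>\<^bsub>loc_module R M S\<^esub> frac (e \<odot>\<^bsub>M\<^esub> y) t"
  \<comment> \<open>The generality of \<open>conv\<close> and \<open>up\<close> in \<open>x\<close>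
    and \<open>y\<close> serves both directions of the associate relation.\<close>
  have conv: "?eq d s x e t y (rfrac c v) \<longleftrightarrow> (v \<otimes> t \<otimes> d) \<odot>\<^bsub>M\<^esub> x = (c \<otimes> e \<otimes> s) \<odot>\<^bsub>M\<^esub> y"
    if "x \<in> carrier M" "y \<in> carrier M" "c \<in> A" "v \<in> S" "d \<in> S" "s \<in> S" "e \<in> S" "t \<in> S"
    for x y c v d s e t
    using that by (simp add: smult_frac frac_eq_iff smult_assoc1 [symmetric] R.m_ac)
  \<comment> \<open>If \<open>x = c y\<close>, the coefficient must turn \<open>e / t\<close> into
    \<open>d / s\<close> besides multiplying by \<open>c\<close>.\<close>
  have up: "?eq d s x e t y (rfrac (d \<otimes> c \<otimes> t) (s \<otimes> e))"
    if "y \<in> carrier M" "c \<in> A" "d \<in> S" "s \<in> S" "e \<in> S" "t \<in> S" "x = c \<odot>\<^bsub>M\<^esub> y"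
    for x y c d s e t
    using that SA by (subst conv) (simp_all add: smult_assoc1 [symmetric] R.m_ac)
  have upT: "rfrac (d \<otimes> c \<otimes> t) (s \<otimes> e) \<in> ?T"
    if "c \<in> A" "d \<in> S" "s \<in> S" "e \<in> S" "t \<in> S" for c d s e t
    using that SA by (subst rfrac_in_loc_set_iff[OF A]) auto
  have upU: "rfrac (d \<otimes> c \<otimes> t) (s \<otimes> e) \<in> Units (loc_ring R S) \<longleftrightarrow> c \<in> S"
    if "c \<in> A" "d \<in> S" "s \<in> S" "e \<in> S" "t \<in> S" for c d s e t
    using that SA by (simp add: rfrac_Units_iff S_mult_iff)
  \<comment> \<open>After cross-multiplication the descent hypothesis removes all denominators. The
    equation between old and new coefficients is kept, since it decides below which of them are
    units.\<close>
  have down: "\<exists>c' \<in> A. x = c' \<odot>\<^bsub>M\<^esub> y \<and> c \<otimes> e \<otimes> s = v \<otimes> t \<otimes> d \<otimes> c'"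
    if "?eq d s x e t y (rfrac c v)" "c \<in> A" "v \<in> S" for c v
    using that S SA closed by (intro xy) (simp_all add: conv)
  have down': "\<exists>c' \<in> A. y = c' \<odot>\<^bsub>M\<^esub> x \<and> c \<otimes> d \<otimes> t = v \<otimes> s \<otimes> e \<otimes> c'"
    if "?eq e t y d s x (rfrac c v)" "c \<in> A" "v \<in> S" for c v
    using that S SA closed by (intro yx) (simp_all add: conv)
  have ex: "(\<exists>C \<in> ?T. ?eq d s x e t y C) \<longleftrightarrow> (\<exists>c \<in> A. x = c \<odot>\<^bsub>M\<^esub> y)"
  proof
    assume "\<exists>C \<in> ?T. ?eq d s x e t y C"
    then obtain c v where "c \<in> A" "v \<in> S" "?eq d s x e t y (rfrac c v)"
      unfolding loc_set_eq by blast
    then show "\<exists>c \<in> A. x = c \<odot>\<^bsub>M\<^esub> y" using down[of c v] by blast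
  next
    assume "\<exists>c \<in> A. x = c \<odot>\<^bsub>M\<^esub> y"
    then obtain c where c: "c \<in> A" "x = c \<odot>\<^bsub>M\<^esub> y" by blast
    show "\<exists>C \<in> ?T. ?eq d s x e t y C"
      by (rule bexI, rule up[OF closed(2) c(1) S c(2)], rule upT[OF c(1) S])
  qed
  have ex': "(\<exists>C \<in> ?T. ?eq e t y d s x C) \<longleftrightarrow> (\<exists>c \<in> A. y = c \<odot>\<^bsub>M\<^esub> x)"
  proof
    assume "\<exists>C \<in> ?T. ?eq e t y d s x C"
    then obtain c v where "c \<in> A" "v \<in> S" "?eq e t y d s x (rfrac c v)"
      unfolding loc_set_eq by blast
    then show "\<exists>c \<in> A. y = c \<odot>\<^bsub>M\<^esub> x" using down'[of c v] by blast
  next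
    assume "\<exists>c \<in> A. y = c \<odot>\<^bsub>M\<^esub> x"
    then obtain c where c: "c \<in> A" "y = c \<odot>\<^bsub>M\<^esub> x" by blast
    show "\<exists>C \<in> ?T. ?eq e t y d s x C"
      by (rule bexI, rule up[OF closed(1) c(1) S(3,4,1,2) c(2)], rule upT[OF c(1) S(3,4,1,2)])
  qed
  have assoc: "S_assoc (loc_ring R S) (loc_module R M S) ?T
      (frac (d \<odot>\<^bsub>M\<^esub> x) s) (frac (e \<odot>\<^bsub>M\<^esub> y) t) \<longleftrightarrow> S_assoc R M A x y"
    using ex ex' unfolding S_assoc_def by blast
  have strong: "S_strong_assoc (loc_ring R S) (loc_module R M S) ?T
      (frac (d \<odot>\<^bsub>M\<^esub> x) s) (frac (e \<odot>\<^bsub>M\<^esub> y) t) \<longleftrightarrow> S_strong_assoc R M A x y" (is "?l \<longleftrightarrow> ?r")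
  proof
    assume ?l
    then obtain c v where cv: "c \<in> A" "v \<in> S" "rfrac c v \<in> Units (loc_ring R S)"
        "?eq d s x e t y (rfrac c v)"
      unfolding S_strong_assoc_def loc_set_eq by blast
    then obtain c' where c': "c' \<in> A" "x = c' \<odot>\<^bsub>M\<^esub> y" "c \<otimes> e \<otimes> s = v \<otimes> t \<otimes> d \<otimes> c'"
      using down[OF cv(4,1,2)] by blast
    \<comment> \<open>A unit fraction has its numerator in \<open>S\<close>. Saturation carries this
      through the coefficient equation to \<open>c'\<close>, and reducedness of \<open>x\<close>
      makes \<open>c'\<close> a unit of \<open>R\<close>.\<close>
    have "c \<in> S" using cv by (simp add: rfrac_Units_iff)
    then have "v \<otimes> t \<otimes> d \<otimes> c' \<in> S" using S unfolding c'(3) [symmetric] by simp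
    then have "c' \<in> S" using S c' cv by (simp add: S_mult_iff)
    then have "c' \<in> Units R" using S_reduced_D[OF x(1) c'(2)] closed by blast
    then show ?r unfolding S_strong_assoc_def using c' by blast
  next
    assume ?r
    then obtain u where u: "u \<in> Units R" "u \<in> A" "x = u \<odot>\<^bsub>M\<^esub> y"
      unfolding S_strong_assoc_def by blast
    then show ?l unfolding S_strong_assoc_def
      using up[OF closed(2) u(2) S u(3)] upT[OF u(2) S] upU[OF u(2) S] Units_S[OF u(1)] by blast
  qed
  have very: "(\<forall>C \<in> ?T. ?eq d s x e t y C \<longrightarrow> C \<in> Units (loc_ring R S)) \<longleftrightarrow>
      (\<forall>c \<in> A. x = c \<odot>\<^bsub>M\<^esub> y \<longrightarrow> c \<in> Units R)" (is "?l \<longleftrightarrow> ?r")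
  proof
    assume l: ?l
    show ?r
    proof (intro ballI impI)
      fix c assume c: "c \<in> A" "x = c \<odot>\<^bsub>M\<^esub> y"
      have "rfrac (d \<otimes> c \<otimes> t) (s \<otimes> e) \<in> Units (loc_ring R S)"
        using l up[OF closed(2) c(1) S c(2)] upT[OF c(1) S] by blast
      then have "c \<in> S" using upU[OF c(1) S] by blast
      then show "c \<in> Units R" using S_reduced_D[OF x(1) c(2)] closed by blast
    qed
  next
    assume r: ?r
    show ?l
    proof (intro ballI impI)
      fix C assume C: "C \<in> ?T" "?eq d s x e t y C"
      then obtain c v where cv: "C = rfrac c v" "c \<in> A" "v \<in> S" by (auto simp: loc_set_eq)
      then obtain c' where c': "c' \<in> A" "x = c' \<odot>\<^bsub>M\<^esub> y" "c \<otimes> e \<otimes> s = v \<otimes> t \<otimes> d \<otimes> c'"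
        using down[of c v] C(2) by blast
      have "c' \<in> S" using r c' Units_S by blast
      then have "c \<otimes> e \<otimes> s \<in> S" unfolding c'(3) using S cv by simp
      then have "c \<in> S" using S cv by (simp add: S_mult_iff)
      then show "C \<in> Units (loc_ring R S)" using cv by (simp add: rfrac_Units_iff)
    qed
  qed
  have nz: "frac (d \<odot>\<^bsub>M\<^esub> x) s \<noteq> \<zero>\<^bsub>loc_module R M S\<^esub>"
    using S closed x(2) by (simp add: frac_zero_iff smult_eq_zero_iff)
  show ?thesis
    using assoc strong very nz x(2) by (cases \<rho>) (simp_all add: S_very_strong_assoc_def)
qed

end

section \<open>Splitting sets\<close>

locale split_module = saturated_module +
  fixes S'
  assumes saturated': "saturated_mult_closed R S'" and S_subset: "S \<subseteq> S'"
    and splits: "splits R M S (carrier M)"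
    and compact: "compactly_S_atomic R (ring_module R) S (S' - annihilator R M)"

sublocale split_module \<subseteq> S': saturated_module R M S'
  by unfold_locales (rule saturated')

context split_module
begin

lemma S_imp_S': "s \<in> S \<Longrightarrow> s \<in> S'"
  using S_subset by blast

lemma saturated_ring_module: "saturated_module R (ring_module R) S"
  by (intro saturated_module.intro ring_module_module saturated_module_axioms.intro saturated)

sublocale RM: saturated_module R "ring_module R" S
  rewrites "carrier (ring_module R) = carrier R" and "smult (ring_module R) = mult R"
    and "\<zero>\<^bsub>ring_module R\<^esub> = \<zero>\<^bsub>R\<^esub>"
  by (rule saturated_ring_module) simp_all

section \<open>Primitive and reduced elements\<close>

lemma not_annihilator:
  "a \<in> carrier R \<Longrightarrow> x \<in> carrier M \<Longrightarrow> a \<odot>\<^bsub>M\<^esub> x \<noteq> \<zero>\<^bsub>M\<^esub> \<Longrightarrow> a \<notin> annihilator R M"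
  by (auto simp: annihilator_def)

text \<open>Semi-factorability compares \<open>x = s y\<close> with \<open>x = 1 x\<close> and makes
  \<open>s\<close> an associate of one. This requires \<open>y\<close> to be primitive too: an
  \<open>S\<close>-divisor \<open>z\<close> of \<open>y\<close> divides \<open>x\<close>, so
  \<open>z = r x = (r s) y\<close>.\<close>

lemma S_primitive_imp_S_reduced:
  assumes x: "S_primitive R M S x" "x \<noteq> \<zero>\<^bsub>M\<^esub>"
  shows "S_reduced R M S x"
  unfolding S_reduced_def
proof (intro conjI ballI impI)
  show xc: "x \<in> carrier M" using x by (simp add: S_primitive_of_def)
  fix s y assume sy: "s \<in> S" "y \<in> carrier M" "x = s \<odot>\<^bsub>M\<^esub> y"
  then have "S_assoc R M S y x" using x by (auto simp: S_primitive_of_def)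
  then obtain s' where s': "s' \<in> S" "y = s' \<odot>\<^bsub>M\<^esub> x" by (auto simp: S_assoc_def)
  have y: "S_primitive R M S y"
    unfolding S_primitive_of_def
  proof (intro conjI ballI impI)
    fix t z assume tz: "t \<in> S" "z \<in> carrier M" "y = t \<odot>\<^bsub>M\<^esub> z"
    then have "x = (s \<otimes> t) \<odot>\<^bsub>M\<^esub> z" using sy by (simp add: smult_assoc1)
    then have "S_assoc R M S z x" using x tz sy by (auto simp: S_primitive_of_def)
    then obtain r where "r \<in> S" "z = r \<odot>\<^bsub>M\<^esub> x" by (auto simp: S_assoc_def)
    then have "z = (r \<otimes> s) \<odot>\<^bsub>M\<^esub> y" using sy by (simp add: smult_assoc1)
    then show "primitive_rel Primitive R M S z y"
      using \<open>r \<in> S\<close> sy tz by (auto simp: S_assoc_def)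
  qed (rule sy)
  have "compact_S_factorization R M S x s y" "compact_S_factorization R M S x \<one> x"
    using x y sy xc by (auto simp: compact_S_factorization_def)
  then have "S_assoc R (ring_module R) (carrier R) s \<one>"
    using splits x(2) xc by (auto simp: splits_def semi_S_factorable_def)
  then obtain c where "c \<in> carrier R" "\<one> = c \<otimes> s" by (auto simp: S_assoc_def)
  then show "s \<in> Units R"
    using R.Units_factor[of s c] sy R.Units_one_closed by (simp add: R.m_comm[of c s])
qed

lemma S_reduced_decomposition:
  assumes "x \<in> carrier M" "x \<noteq> \<zero>\<^bsub>M\<^esub>"
  obtains s y where "s \<in> S" "S_reduced R M S y" "y \<noteq> \<zero>\<^bsub>M\<^esub>" "x = s \<odot>\<^bsub>M\<^esub> y"
proof -
  obtain s y where sy: "s \<in> S" "S_primitive R M S y" "x = s \<odot>\<^bsub>M\<^esub> y"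
    using assms splits
    by (auto simp: splits_def semi_S_factorable_def compactly_S_atomic_def compact_S_factorization_def)
  then have "y \<noteq> \<zero>\<^bsub>M\<^esub>" using assms by auto
  then show thesis using that sy S_primitive_imp_S_reduced by blast
qed

text \<open>Condition (ii) of splitting, carried over to reduced elements by passing to primitive
  ones and back.\<close>

lemma S_reduced_smult:
  assumes r: "S_reduced R (ring_module R) S r" and x: "S_reduced R M S x"
    and nz: "r \<odot>\<^bsub>M\<^esub> x \<noteq> \<zero>\<^bsub>M\<^esub>"
  shows "S_reduced R M S (r \<odot>\<^bsub>M\<^esub> x)"
proof -
  have "S_primitive R (ring_module R) S r" "S_primitive R M S x"
    using RM.S_reduced_imp_S_primitive_of[OF r] S_reduced_imp_S_primitive_of[OF x] by auto
  moreover have "r \<odot>\<^bsub>M\<^esub> x \<in> carrier M"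
    using RM.S_reduced_closed[OF r] S_reduced_closed[OF x] by simp
  ultimately show ?thesis
    using splits nz S_primitive_imp_S_reduced by (auto simp: splits_def)
qed

text \<open>If \<open>a x\<close> is nonzero and \<open>x = s y\<close> with \<open>y\<close>
  reduced, then \<open>a x = s (a y)\<close>. Non-annihilation can therefore be tested on a reduced
  element.\<close>

lemma S_reduced_witness:
  assumes "a \<in> carrier R" "a \<notin> annihilator R M"
  obtains y where "S_reduced R M S y" "a \<odot>\<^bsub>M\<^esub> y \<noteq> \<zero>\<^bsub>M\<^esub>"
proof -
  obtain x where x: "x \<in> carrier M" "a \<odot>\<^bsub>M\<^esub> x \<noteq> \<zero>\<^bsub>M\<^esub>"
    using assms by (auto simp: annihilator_def)
  then have "x \<noteq> \<zero>\<^bsub>M\<^esub>" using assms by auto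
  then obtain s y where sy: "s \<in> S" "S_reduced R M S y" "x = s \<odot>\<^bsub>M\<^esub> y"
    using S_reduced_decomposition x by metis
  then have "a \<odot>\<^bsub>M\<^esub> x = s \<odot>\<^bsub>M\<^esub> (a \<odot>\<^bsub>M\<^esub> y)"
    using assms S_reduced_closed by (simp add: smult_assoc1 [symmetric] R.m_comm)
  then show thesis using that sy x by force
qed

text \<open>Compactness supplies only a primitive \<open>r\<close>, while uniqueness of coefficients
  is available in \<open>M\<close>. Reducedness of \<open>r\<close> is therefore detected on a
  reduced \<open>y\<close> with \<open>r y\<close> nonzero: splitting makes \<open>r y\<close>
  primitive, hence reduced, and an \<open>S\<close>-factor of \<open>r\<close> is one of
  \<open>r y\<close>.\<close>

lemma ring_S_reduced_decomposition:
  assumes a: "a \<in> S'" "a \<notin> annihilator R M"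
  obtains s r where "s \<in> S" "r \<in> S'" "r \<notin> annihilator R M" "S_reduced R (ring_module R) S r"
    "a = s \<otimes> r"
proof -
  have "\<zero> \<in> annihilator R M" by (auto simp: annihilator_def)
  then obtain s r where sr: "s \<in> S" "S_primitive R (ring_module R) S r" "a = s \<otimes> r"
    using a compact unfolding compactly_S_atomic_def compact_S_factorization_def
    by (metis DiffI ring_module_simps(2,3))
  have rc: "r \<in> carrier R" using sr by (simp add: S_primitive_of_def)
  then have rS: "r \<in> S'" using S'.S_factor[of s r] sr a by auto
  have r: "r \<notin> annihilator R M"
    using a(2) sr rc smult_r_null by (force simp: annihilator_def smult_assoc1)
  obtain y where y: "S_reduced R M S y" "r \<odot>\<^bsub>M\<^esub> y \<noteq> \<zero>\<^bsub>M\<^esub>"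
    using S_reduced_witness[OF rc r] by blast
  have "S_primitive R M S (r \<odot>\<^bsub>M\<^esub> y)"
    using splits sr S_reduced_imp_S_primitive_of[OF y(1)] y(2) S_reduced_closed[OF y(1)] rc
    by (auto simp: splits_def)
  then have ry: "S_reduced R M S (r \<odot>\<^bsub>M\<^esub> y)" using S_primitive_imp_S_reduced y by blast
  have "S_reduced R (ring_module R) S r"
    unfolding S_reduced_def
  proof (intro conjI ballI impI)
    fix t z assume tz: "t \<in> S" "z \<in> carrier (ring_module R)" "r = t \<odot>\<^bsub>ring_module R\<^esub> z"
    then have "r \<odot>\<^bsub>M\<^esub> y = t \<odot>\<^bsub>M\<^esub> (z \<odot>\<^bsub>M\<^esub> y)"
      using S_reduced_closed[OF y(1)] by (simp add: smult_assoc1)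
    then show "t \<in> Units R"
      using S_reduced_D[OF ry] tz S_reduced_closed[OF y(1)] by simp
  qed (use rc in simp)
  then show thesis using that sr rS r by blast
qed

text \<open>Write \<open>y = t k\<close> with \<open>k\<close> reduced. Primitivity for the larger
  set makes \<open>k\<close> a multiple of \<open>x\<close>, which exhibits \<open>s\<close> as an
  \<open>S\<close>-factor of \<open>k\<close>.\<close>

lemma S'_primitive_imp_S_reduced:
  assumes x: "S_primitive_of \<beta> R M S' x" and nz: "x \<noteq> \<zero>\<^bsub>M\<^esub>"
  shows "S_reduced R M S x"
  unfolding S_reduced_def
proof (intro conjI ballI impI)
  have x': "S_primitive R M S' x" using x by (rule S'.S_primitive_of_imp_S_primitive)
  then show xc: "x \<in> carrier M" by (simp add: S_primitive_of_def)
  fix s y assume sy: "s \<in> S" "y \<in> carrier M" "x = s \<odot>\<^bsub>M\<^esub> y"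
  then have "y \<noteq> \<zero>\<^bsub>M\<^esub>" using nz by auto
  then obtain t k where tk: "t \<in> S" "S_reduced R M S k" "y = t \<odot>\<^bsub>M\<^esub> k"
    using S_reduced_decomposition[OF sy(2)] by metis
  have kc: "k \<in> carrier M" using tk S_reduced_closed by blast
  have xk: "x = (s \<otimes> t) \<odot>\<^bsub>M\<^esub> k" using sy tk kc by (simp add: smult_assoc1)
  then have "S_assoc R M S' k x" using x' kc sy tk S_imp_S' by (auto simp: S_primitive_of_def)
  then obtain c where c: "c \<in> S'" "k = c \<odot>\<^bsub>M\<^esub> x" by (auto simp: S_assoc_def)
  have "k = c \<odot>\<^bsub>M\<^esub> ((s \<otimes> t) \<odot>\<^bsub>M\<^esub> k)"
    using c(2) unfolding xk .
  also have "\<dots> = s \<odot>\<^bsub>M\<^esub> ((c \<otimes> t) \<odot>\<^bsub>M\<^esub> k)"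
    using kc sy(1) tk(1) c(1) by (simp add: smult_assoc1 [symmetric] R.m_ac)
  finally show "s \<in> Units R"
    by (rule S_reduced_D[OF tk(2)]) (use sy(1) c(1) tk(1) kc in auto)
qed

section \<open>Splitting an \<open>S'\<close>-factorization\<close>

lemma irreducible_in_S_or_S_reduced:
  assumes a: "irreducible_of \<alpha> R a" "a \<in> S'" "a \<notin> annihilator R M"
  shows "a \<in> S \<or> S_reduced R (ring_module R) S a"
proof -
  obtain t r where tr: "t \<in> S" "r \<in> S'" "r \<notin> annihilator R M"
    "S_reduced R (ring_module R) S r" "a = t \<otimes> r"
    by (rule ring_S_reduced_decomposition[OF a(2,3)])
  have tc: "t \<in> carrier R" "r \<in> carrier R" "a \<in> carrier R" using tr a by blast+
  have "irreducible_rel \<alpha> R a t \<or> irreducible_rel \<alpha> R a r"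
    using a(1) tr(5) tc unfolding irreducible_of_def by blast
  \<comment> \<open>This common consequence of the three relations treats every \<alpha> at
    once.\<close>
  moreover have "\<exists>c \<in> carrier R. b = c \<otimes> a" if rel: "irreducible_rel \<alpha> R a b" "b \<in> carrier R" for b
  proof (cases \<alpha>)
    case Strongly_Irreducible
    then obtain u where "u \<in> Units R" "a = u \<otimes> b" using rel(1) Strongly_Irreducible
      by (auto simp: S_strong_assoc_def)
    then have "b = inv u \<otimes> a"
      using rel(2) by (simp add: R.m_assoc [symmetric] R.Units_closed)
    then show ?thesis using \<open>u \<in> Units R\<close> by blast
  qed (use rel in \<open>auto simp: S_assoc_def S_very_strong_assoc_def\<close>)
  ultimately consider c where "c \<in> carrier R" "t = c \<otimes> a" | c where "c \<in> carrier R" "r = c \<otimes> a"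
    using tc by blast
  then show ?thesis
  proof cases
    case 1
    then have "c \<otimes> a \<in> S" using tr(1) by blast
    then show ?thesis using S_factor[OF 1(1) tc(3)] by blast
  next
    case 2
    \<comment> \<open>Here \<open>r = c a\<close>, so substituting \<open>a = t r\<close> shows
      \<open>t\<close> to be an \<open>S\<close>-factor of the reduced \<open>r\<close>.\<close>
    have "c \<otimes> a = t \<otimes> (c \<otimes> r)" unfolding tr(5) using tc 2(1) by (simp add: R.m_ac)
    then have "t \<in> Units R"
      using RM.S_reduced_D[OF tr(4), of t "c \<otimes> r"] tr(1) tc 2 R.m_closed by metis
    then show ?thesis using RM.S_reduced_unit[OF tr(4)] unfolding tr(5) by blast
  qed
qed

text \<open>Induction on the factors. A nonzero product has nonzero tails, so no factor kills
  \<open>M\<close>, and multiplying by a reduced factor keeps the module part reduced. The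
  properties of \<open>rs\<close> are recorded because these are the factors that stay irreducible
  in the localization.\<close>

lemma split_factors:
  assumes y: "S_reduced R M S y"
    and "\<And>a. a \<in> set as \<Longrightarrow> a \<in> S' \<and> irreducible_of \<alpha> R a"
    and "foldr (\<otimes>) as \<one> \<odot>\<^bsub>M\<^esub> y \<noteq> \<zero>\<^bsub>M\<^esub>"
  shows "\<exists>ss rs. set ss \<subseteq> set as \<inter> S \<and>
    set rs \<subseteq> {r \<in> set as. r \<notin> S \<and> r \<notin> annihilator R M \<and> S_reduced R (ring_module R) S r} \<and>
    foldr (\<otimes>) as \<one> \<odot>\<^bsub>M\<^esub> y = foldr (\<otimes>) ss \<one> \<odot>\<^bsub>M\<^esub> (foldr (\<otimes>) rs \<one> \<odot>\<^bsub>M\<^esub> y) \<and>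
    S_reduced R M S (foldr (\<otimes>) rs \<one> \<odot>\<^bsub>M\<^esub> y)"
  using assms(2,3)
proof (induction as)
  case Nil
  have "y \<in> carrier M" using y by (rule S_reduced_closed)
  then show ?case using y by (intro exI[of _ "[]"]) simp
next
  case (Cons a as)
  have yc: "y \<in> carrier M" using y by (rule S_reduced_closed)
  have a: "a \<in> S'" "irreducible_of \<alpha> R a" using Cons.prems(1) by auto
  have as: "set as \<subseteq> carrier R" using Cons.prems(1) by auto
  have step: "foldr (\<otimes>) (a # as) \<one> \<odot>\<^bsub>M\<^esub> y = a \<odot>\<^bsub>M\<^esub> (foldr (\<otimes>) as \<one> \<odot>\<^bsub>M\<^esub> y)"
    using a as yc by (simp add: smult_assoc1)
  then have nz: "foldr (\<otimes>) as \<one> \<odot>\<^bsub>M\<^esub> y \<noteq> \<zero>\<^bsub>M\<^esub>" using Cons.prems(2) a by auto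
  have IH: "b \<in> S' \<and> irreducible_of \<alpha> R b" if "b \<in> set as" for b
    using Cons.prems(1) that by simp
  from Cons.IH[OF IH nz] obtain ss rs where ss: "set ss \<subseteq> set as \<inter> S" and
    rs: "set rs \<subseteq> {r \<in> set as. r \<notin> S \<and> r \<notin> annihilator R M \<and> S_reduced R (ring_module R) S r}"
    and eq: "foldr (\<otimes>) as \<one> \<odot>\<^bsub>M\<^esub> y = foldr (\<otimes>) ss \<one> \<odot>\<^bsub>M\<^esub> (foldr (\<otimes>) rs \<one> \<odot>\<^bsub>M\<^esub> y)"
    and red: "S_reduced R M S (foldr (\<otimes>) rs \<one> \<odot>\<^bsub>M\<^esub> y)"
    by blast
  have cl: "foldr (\<otimes>) ss \<one> \<in> carrier R" "foldr (\<otimes>) rs \<one> \<in> carrier R"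
    using ss rs as by (auto intro!: foldr_mult_closed)
  have ann: "a \<notin> annihilator R M"
    using Cons.prems(2) step not_annihilator[of a "foldr (\<otimes>) as \<one> \<odot>\<^bsub>M\<^esub> y"] a as yc by auto
  show ?case
  proof (cases "a \<in> S")
    case True
    then show ?thesis
      using ss rs red step eq cl yc a
      by (intro exI[of _ "a # ss"] exI[of _ rs]) (auto simp: smult_assoc1)
  next
    case False
    then have ar: "S_reduced R (ring_module R) S a"
      using irreducible_in_S_or_S_reduced a ann by blast
    have eq': "foldr (\<otimes>) (a # as) \<one> \<odot>\<^bsub>M\<^esub> y =
        foldr (\<otimes>) ss \<one> \<odot>\<^bsub>M\<^esub> (foldr (\<otimes>) (a # rs) \<one> \<odot>\<^bsub>M\<^esub> y)"
      unfolding step eq using cl yc a by (simp add: smult_assoc1 [symmetric] R.m_ac)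
    have sp: "foldr (\<otimes>) (a # rs) \<one> \<odot>\<^bsub>M\<^esub> y = a \<odot>\<^bsub>M\<^esub> (foldr (\<otimes>) rs \<one> \<odot>\<^bsub>M\<^esub> y)"
      using cl yc a by (simp add: smult_assoc1)
    have "foldr (\<otimes>) (a # rs) \<one> \<odot>\<^bsub>M\<^esub> y \<noteq> \<zero>\<^bsub>M\<^esub>"
      using Cons.prems(2) cl unfolding eq' by auto
    then have "S_reduced R M S (foldr (\<otimes>) (a # rs) \<one> \<odot>\<^bsub>M\<^esub> y)"
      unfolding sp by (intro S_reduced_smult ar red)
    then show ?thesis
      using ss rs eq' False ann ar by (intro exI[of _ ss] exI[of _ "a # rs"]) auto
  qed
qed

lemma S_factorization_split:
  assumes "S_factorization \<alpha> \<beta> R M S' x as y" and nz: "x \<noteq> \<zero>\<^bsub>M\<^esub>"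
  obtains ss rs where "set ss \<subseteq> set as \<inter> S"
    "set rs \<subseteq> {r \<in> set as. r \<notin> S \<and> r \<notin> annihilator R M \<and> S_reduced R (ring_module R) S r}"
    "x = foldr (\<otimes>) ss \<one> \<odot>\<^bsub>M\<^esub> (foldr (\<otimes>) rs \<one> \<odot>\<^bsub>M\<^esub> y)"
    "S_reduced R M S (foldr (\<otimes>) rs \<one> \<odot>\<^bsub>M\<^esub> y)" "S_reduced R M S y"
proof -
  have as: "\<And>a. a \<in> set as \<Longrightarrow> a \<in> S' \<and> irreducible_of \<alpha> R a"
    and x: "x = foldr (\<otimes>) as \<one> \<odot>\<^bsub>M\<^esub> y" and y: "S_primitive_of \<beta> R M S' y"
    using assms by (auto simp: S_factorization_def)
  have "set as \<subseteq> carrier R" using as by auto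
  then have "y \<noteq> \<zero>\<^bsub>M\<^esub>" using x nz by auto
  then have red: "S_reduced R M S y" using y S'_primitive_imp_S_reduced by blast
  then show thesis using split_factors[OF red as] that x nz by blast
qed

text \<open>The type \<gamma> is arbitrary because the collected part is reduced: it is taken very
  strongly primitive for (1) and primitive for (2).\<close>

lemma S_atomic_of_S'_atomic:
  assumes "S_atomic \<alpha> \<beta> R M S'"
  shows "S_atomic \<alpha> \<gamma> R M S"
  unfolding S_atomic_def
proof (intro ballI impI)
  fix x assume x: "x \<in> carrier M" "x \<noteq> \<zero>\<^bsub>M\<^esub>"
  then obtain as y where f: "S_factorization \<alpha> \<beta> R M S' x as y"
    using assms by (auto simp: S_atomic_def)
  obtain ss rs where "set ss \<subseteq> set as \<inter> S"
    "set rs \<subseteq> {r \<in> set as. r \<notin> S \<and> r \<notin> annihilator R M \<and> S_reduced R (ring_module R) S r}"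
    "x = foldr (\<otimes>) ss \<one> \<odot>\<^bsub>M\<^esub> (foldr (\<otimes>) rs \<one> \<odot>\<^bsub>M\<^esub> y)"
    "S_reduced R M S (foldr (\<otimes>) rs \<one> \<odot>\<^bsub>M\<^esub> y)" "S_reduced R M S y"
    by (rule S_factorization_split[OF f x(2)])
  then have "S_factorization \<alpha> \<gamma> R M S x ss (foldr (\<otimes>) rs \<one> \<odot>\<^bsub>M\<^esub> y)"
    using f S_reduced_imp_S_primitive_of by (auto simp: S_factorization_def)
  then show "\<exists>ss y. S_factorization \<alpha> \<gamma> R M S x ss y" by blast
qed

end

section \<open>Splitting sets of regular elements\<close>

locale regular_split_module = split_module + regular_module
begin

section \<open>Descent of equations between reduced elements\<close>

abbreviation reduced_coeff where
  "reduced_coeff r \<equiv> r \<in> S' \<and> r \<notin> annihilator R M \<and> S_reduced R (ring_module R) S r"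

lemma reduced_coeff_carrier: "reduced_coeff r \<Longrightarrow> r \<in> carrier R"
  by blast

text \<open>Semi-factorability makes \<open>v\<close> and \<open>d\<close> associates,
  \<open>v = c d\<close> and \<open>d = w v\<close>. Regularity of \<open>v\<close> then gives
  \<open>w c = 1\<close>, so \<open>w\<close> is a unit, and cancelling \<open>v\<close> in
  \<open>v x = v (w y)\<close> yields the rest.\<close>

lemma S_reduced_unique:
  assumes x: "S_reduced R M S x" "x \<noteq> \<zero>\<^bsub>M\<^esub>" and y: "S_reduced R M S y"
    and S: "v \<in> S" "d \<in> S" and eq: "v \<odot>\<^bsub>M\<^esub> x = d \<odot>\<^bsub>M\<^esub> y"
  shows "\<exists>w \<in> Units R. x = w \<odot>\<^bsub>M\<^esub> y \<and> d = v \<otimes> w"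
proof -
  have xy: "x \<in> carrier M" "y \<in> carrier M" using x y S_reduced_closed by blast+
  have nz: "v \<odot>\<^bsub>M\<^esub> x \<noteq> \<zero>\<^bsub>M\<^esub>" using x(2) xy S by (simp add: smult_eq_zero_iff)
  have "compact_S_factorization R M S (v \<odot>\<^bsub>M\<^esub> x) v x" "compact_S_factorization R M S (v \<odot>\<^bsub>M\<^esub> x) d y"
    unfolding compact_S_factorization_def
    using S eq S_reduced_imp_S_primitive_of[OF x(1)] S_reduced_imp_S_primitive_of[OF y] by blast+
  then have "S_assoc R (ring_module R) (carrier R) v d"
    using splits nz smult_closed[OF S_carrier[OF S(1)] xy(1)]
    unfolding splits_def semi_S_factorable_def by blast
  then obtain c w where c: "c \<in> carrier R" "v = c \<otimes> d" and w: "w \<in> carrier R" "d = w \<otimes> v"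
    unfolding S_assoc_def ring_module_simps by blast
  have "v \<otimes> (w \<otimes> c) = c \<otimes> (w \<otimes> v)"
    using S c(1) w(1) by (simp add: R.m_ac)
  also have "\<dots> = v \<otimes> \<one>"
    using S(1) by (simp only: w(2) [symmetric] c(2) [symmetric] R.r_one S_carrier)
  finally have "w \<otimes> c = \<one>"
    using mult_cancel[OF S(1), of "w \<otimes> c" \<one>] c(1) w(1) by simp
  then have "w \<in> Units R"
    using R.Units_factor[OF w(1) c(1)] by simp
  moreover have d: "d = v \<otimes> w" using w S by (simp add: R.m_comm)
  moreover have "x = w \<odot>\<^bsub>M\<^esub> y"
    using eq smult_cancel[OF S(1) xy(1), of "w \<odot>\<^bsub>M\<^esub> y"] w(1) xy S unfolding d
    by (simp add: smult_assoc1)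
  ultimately show ?thesis by blast
qed

text \<open>Decompose \<open>c = d r\<close> with \<open>r\<close> reduced. Then \<open>r y\<close>
  is reduced, and uniqueness for \<open>v x = d (r y)\<close> gives a unit \<open>w\<close> with
  \<open>d = v w\<close>; the witness is \<open>w r\<close>.\<close>

lemma smult_split:
  assumes x: "S_reduced R M S x" "x \<noteq> \<zero>\<^bsub>M\<^esub>" and y: "S_reduced R M S y"
    and v: "v \<in> S" and c: "c \<in> S'" and eq: "v \<odot>\<^bsub>M\<^esub> x = c \<odot>\<^bsub>M\<^esub> y"
  shows "\<exists>c' \<in> S'. x = c' \<odot>\<^bsub>M\<^esub> y \<and> c = v \<otimes> c'"
proof -
  have xy: "x \<in> carrier M" "y \<in> carrier M" using x y S_reduced_closed by blast+
  have nz: "c \<odot>\<^bsub>M\<^esub> y \<noteq> \<zero>\<^bsub>M\<^esub>"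
    using x(2) xy v unfolding eq [symmetric] by (simp add: smult_eq_zero_iff)
  then have ann: "c \<notin> annihilator R M" using not_annihilator c xy by blast
  obtain d r where dr: "d \<in> S" "r \<in> S'" "r \<notin> annihilator R M"
    "S_reduced R (ring_module R) S r" "c = d \<otimes> r"
    by (rule ring_S_reduced_decomposition[OF c ann])
  have cy: "c \<odot>\<^bsub>M\<^esub> y = d \<odot>\<^bsub>M\<^esub> (r \<odot>\<^bsub>M\<^esub> y)" unfolding dr(5) using dr(1,2) xy by (simp add: smult_assoc1)
  then have "r \<odot>\<^bsub>M\<^esub> y \<noteq> \<zero>\<^bsub>M\<^esub>" using nz dr(1) by auto
  then have red: "S_reduced R M S (r \<odot>\<^bsub>M\<^esub> y)" using S_reduced_smult[OF dr(4) y] by blast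
  then obtain w where w: "w \<in> Units R" "x = w \<odot>\<^bsub>M\<^esub> (r \<odot>\<^bsub>M\<^esub> y)" "d = v \<otimes> w"
    using S_reduced_unique[OF x red v dr(1) eq [unfolded cy]] by blast
  have wS: "w \<in> S'" using w(1) S'.Units_S by blast
  have "x = (w \<otimes> r) \<odot>\<^bsub>M\<^esub> y" unfolding w(2) using wS dr(2) xy by (simp add: smult_assoc1)
  moreover have "c = v \<otimes> (w \<otimes> r)" unfolding dr(5) w(3) using wS dr(2) v by (simp add: R.m_assoc)
  moreover have "w \<otimes> r \<in> S'" using wS dr(2) by simp
  ultimately show ?thesis by blast
qed

lemma reduced_coeff_witness:
  assumes "reduced_coeff a"
  obtains y where "S_reduced R M S y" "y \<in> carrier M" "a \<odot>\<^bsub>M\<^esub> y \<noteq> \<zero>\<^bsub>M\<^esub>" "S_reduced R M S (a \<odot>\<^bsub>M\<^esub> y)"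
proof -
  obtain y where "S_reduced R M S y" "a \<odot>\<^bsub>M\<^esub> y \<noteq> \<zero>\<^bsub>M\<^esub>"
    using S_reduced_witness assms by blast
  then show thesis using that[of y] S_reduced_smult[of a y] assms S_reduced_closed[of y] by blast
qed

text \<open>Splitting is assumed for \<open>M\<close> and not for \<open>R\<close>, so the equation
  is applied to a \<open>y\<close> with \<open>a y\<close> nonzero and reduced, where
  \<open>smult_split\<close> finds the coefficient. Saturation puts \<open>c\<close> into
  \<open>S'\<close> beforehand.\<close>

lemma mult_split:
  assumes a: "reduced_coeff a" and b: "reduced_coeff b"
    and v: "v \<in> S" and c: "c \<in> carrier R" and eq: "v \<otimes> a = c \<otimes> b"
  shows "\<exists>c' \<in> carrier R. a = c' \<otimes> b \<and> c = v \<otimes> c'"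
proof -
  have ab: "a \<in> carrier R" "b \<in> carrier R" using a b by blast+
  have "v \<otimes> a \<in> S'" using a v S_imp_S' by simp
  then have cS: "c \<in> S'" using S'.S_mult_iff[OF c ab(2)] unfolding eq by blast
  obtain y where y: "S_reduced R M S y" "y \<in> carrier M" "a \<odot>\<^bsub>M\<^esub> y \<noteq> \<zero>\<^bsub>M\<^esub>" "S_reduced R M S (a \<odot>\<^bsub>M\<^esub> y)"
    using reduced_coeff_witness[OF a] .
  have "v \<odot>\<^bsub>M\<^esub> (a \<odot>\<^bsub>M\<^esub> y) = (v \<otimes> a) \<odot>\<^bsub>M\<^esub> y" using v ab y(2) by (simp add: smult_assoc1)
  also have "\<dots> = c \<odot>\<^bsub>M\<^esub> (b \<odot>\<^bsub>M\<^esub> y)" unfolding eq using c ab y(2) by (simp add: smult_assoc1)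
  finally have eq': "v \<odot>\<^bsub>M\<^esub> (a \<odot>\<^bsub>M\<^esub> y) = c \<odot>\<^bsub>M\<^esub> (b \<odot>\<^bsub>M\<^esub> y)" .
  have "v \<odot>\<^bsub>M\<^esub> (a \<odot>\<^bsub>M\<^esub> y) \<noteq> \<zero>\<^bsub>M\<^esub>" using y ab v by (simp add: smult_eq_zero_iff)
  then have "b \<odot>\<^bsub>M\<^esub> y \<noteq> \<zero>\<^bsub>M\<^esub>" unfolding eq' using c by auto
  then have "S_reduced R M S (b \<odot>\<^bsub>M\<^esub> y)" using S_reduced_smult[of b y] b y(1) by blast
  then obtain c' where c': "c' \<in> S'" "c = v \<otimes> c'"
    using smult_split[OF y(4,3) _ v cS eq'] by blast
  have "v \<otimes> a = v \<otimes> (c' \<otimes> b)" unfolding eq c'(2) using v c'(1) ab by (simp add: R.m_assoc)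
  then have "a = c' \<otimes> b" using mult_cancel[OF v ab(1)] c'(1) ab(2) by simp
  then show ?thesis using c' by blast
qed

lemma reduced_coeff_unit:
  assumes b: "reduced_coeff b" and u: "u \<in> Units R"
  shows "reduced_coeff (u \<otimes> b)"
proof -
  have uS: "u \<in> S" and bc: "b \<in> carrier R" using u b Units_S by blast+
  obtain y where y: "y \<in> carrier M" "b \<odot>\<^bsub>M\<^esub> y \<noteq> \<zero>\<^bsub>M\<^esub>"
    using reduced_coeff_witness[OF b] by blast
  then have "(u \<otimes> b) \<odot>\<^bsub>M\<^esub> y \<noteq> \<zero>\<^bsub>M\<^esub>" using b uS by (simp add: smult_assoc1 smult_eq_zero_iff)
  then have "u \<otimes> b \<notin> annihilator R M" 
    using not_annihilator[OF R.m_closed[OF S_carrier[OF uS] bc] y(1)] by blast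
  then show ?thesis using RM.S_reduced_unit[of b u] b u uS S_imp_S' by simp
qed

text \<open>A member of \<open>S\<close> is an \<open>S\<close>-factor of itself, by
  \<open>a = a 1\<close>.\<close>

lemma reduced_coeff_in_S: "reduced_coeff a \<Longrightarrow> a \<in> S \<longleftrightarrow> a \<in> Units R"
  using RM.S_reduced_D[of a a \<one>] Units_S by auto

lemma reduced_coeff_factor:
  assumes a: "reduced_coeff (b \<otimes> c)" and bc: "b \<in> carrier R" "c \<in> carrier R"
  shows "reduced_coeff b"
proof -
  obtain y where y: "y \<in> carrier M" "(b \<otimes> c) \<odot>\<^bsub>M\<^esub> y \<noteq> \<zero>\<^bsub>M\<^esub>"
    using reduced_coeff_witness[OF a] by blast
  then have "b \<notin> annihilator R M"
    using not_annihilator[OF bc(1), of "c \<odot>\<^bsub>M\<^esub> y"] bc by (simp add: smult_assoc1)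
  moreover have "S_reduced R (ring_module R) S b"
    using RM.S_reduced_factor[of c b] a bc by (simp add: R.m_comm)
  ultimately show ?thesis using a S'.S_mult_iff[OF bc] by blast
qed

text \<open>Brings a factorization over the localization back to \<open>R\<close>: the
  \<open>S\<close>-parts of \<open>b\<close> and \<open>c\<close> are split off so that the reduced
  parts multiply to \<open>a\<close> exactly. As before, the comparison is made on a witness
  \<open>y\<close> in \<open>M\<close>.\<close>

lemma mult_decomposition:
  assumes a: "reduced_coeff a" and S: "v \<in> S" "w \<in> S"
    and bc: "b \<in> carrier R" "c \<in> carrier R" and eq: "v \<otimes> a = w \<otimes> (b \<otimes> c)"
  obtains d b' e c' where "d \<in> S" "reduced_coeff b'" "e \<in> S" "reduced_coeff c'"
    "b = d \<otimes> b'" "c = e \<otimes> c'" "a = b' \<otimes> c'"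
proof -
  obtain y where y: "S_reduced R M S y" "y \<in> carrier M" "a \<odot>\<^bsub>M\<^esub> y \<noteq> \<zero>\<^bsub>M\<^esub>" "S_reduced R M S (a \<odot>\<^bsub>M\<^esub> y)"
    using reduced_coeff_witness[OF a] .
  have ac: "a \<in> carrier R" using a by blast
  have "v \<otimes> a \<in> S'" using a S S_imp_S' by simp
  then have bcS: "b \<in> S'" "c \<in> S'"
    unfolding eq using S'.S_mult_iff[of w "b \<otimes> c"] S'.S_mult_iff[OF bc] bc S by auto
  have vay: "v \<odot>\<^bsub>M\<^esub> (a \<odot>\<^bsub>M\<^esub> y) \<noteq> \<zero>\<^bsub>M\<^esub>" using y ac S by (simp add: smult_eq_zero_iff)
  have eq': "v \<odot>\<^bsub>M\<^esub> (a \<odot>\<^bsub>M\<^esub> y) = (w \<otimes> (b \<otimes> c)) \<odot>\<^bsub>M\<^esub> y"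
    unfolding eq [symmetric] using S ac y(2) by (simp add: smult_assoc1)
  have "(w \<otimes> (b \<otimes> c)) \<odot>\<^bsub>M\<^esub> y = b \<odot>\<^bsub>M\<^esub> ((w \<otimes> c) \<odot>\<^bsub>M\<^esub> y)"
    "(w \<otimes> (b \<otimes> c)) \<odot>\<^bsub>M\<^esub> y = c \<odot>\<^bsub>M\<^esub> ((w \<otimes> b) \<odot>\<^bsub>M\<^esub> y)"
    using S bc y(2) by (simp_all add: smult_assoc1 [symmetric] R.m_ac)
  then have ann: "b \<notin> annihilator R M" "c \<notin> annihilator R M"
    using not_annihilator[OF bc(1), of "(w \<otimes> c) \<odot>\<^bsub>M\<^esub> y"] not_annihilator[OF bc(2), of "(w \<otimes> b) \<odot>\<^bsub>M\<^esub> y"]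
      vay eq' S bc y(2) by simp_all
  obtain d b0 where d: "d \<in> S" "b0 \<in> S'" "b0 \<notin> annihilator R M"
      "S_reduced R (ring_module R) S b0" "b = d \<otimes> b0"
    by (rule ring_S_reduced_decomposition[OF bcS(1) ann(1)])
  obtain e c0 where e: "e \<in> S" "c0 \<in> S'" "c0 \<notin> annihilator R M"
      "S_reduced R (ring_module R) S c0" "c = e \<otimes> c0"
    by (rule ring_S_reduced_decomposition[OF bcS(2) ann(2)])
  have eq'': "v \<odot>\<^bsub>M\<^esub> (a \<odot>\<^bsub>M\<^esub> y) = (w \<otimes> d \<otimes> e) \<odot>\<^bsub>M\<^esub> (b0 \<odot>\<^bsub>M\<^esub> (c0 \<odot>\<^bsub>M\<^esub> y))"
    unfolding eq' d(5) e(5) using S d(1,2) e(1,2) y(2)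
    by (simp add: smult_assoc1 [symmetric] R.m_ac)
  then have nz: "b0 \<odot>\<^bsub>M\<^esub> (c0 \<odot>\<^bsub>M\<^esub> y) \<noteq> \<zero>\<^bsub>M\<^esub>" using vay S d(1) e(1) by auto
  then have "c0 \<odot>\<^bsub>M\<^esub> y \<noteq> \<zero>\<^bsub>M\<^esub>" using d(2) by auto
  then have red_c: "S_reduced R M S (c0 \<odot>\<^bsub>M\<^esub> y)" by (rule S_reduced_smult[OF e(4) y(1)])
  have red: "S_reduced R M S (b0 \<odot>\<^bsub>M\<^esub> (c0 \<odot>\<^bsub>M\<^esub> y))"
    by (rule S_reduced_smult[OF d(4) red_c nz])
  obtain u where u: "u \<in> Units R" "w \<otimes> d \<otimes> e = v \<otimes> u"
    using S_reduced_unique[OF y(4,3) red S(1) _ eq''] S(2) d(1) e(1) S_mult by blast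
  have uc: "u \<in> carrier R" using u(1) by blast
  have "v \<otimes> a = (w \<otimes> d \<otimes> e) \<otimes> (b0 \<otimes> c0)"
    unfolding eq d(5) e(5) using S d(1,2) e(1,2) by (simp add: R.m_ac)
  also have "\<dots> = v \<otimes> (u \<otimes> b0 \<otimes> c0)"
    unfolding u(2) using uc S d(2) e(2) by (simp add: R.m_assoc)
  finally have "a = u \<otimes> b0 \<otimes> c0"
    using mult_cancel[OF S(1) ac, of "u \<otimes> b0 \<otimes> c0"] uc d(2) e(2) by simp
  \<comment> \<open>The unit by which the two \<open>S\<close>-coefficients differ is absorbed into
    \<open>b0\<close>, and its inverse into \<open>d\<close>.\<close>
  moreover have "b = (d \<otimes> inv u) \<otimes> (u \<otimes> b0)"
  proof -
    have "(d \<otimes> inv u) \<otimes> (u \<otimes> b0) = d \<otimes> (inv u \<otimes> u) \<otimes> b0"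
      using d(1,2) uc R.Units_inv_closed[OF u(1)] by (simp add: R.m_assoc del: R.Units_l_inv)
    then show ?thesis using d(1,2) u(1) unfolding d(5) by simp
  qed
  moreover have "d \<otimes> inv u \<in> S" using d(1) u(1) Units_S R.Units_inv_Units by blast
  moreover have "reduced_coeff (u \<otimes> b0)" using reduced_coeff_unit[of b0 u] d(2-4) u(1) by blast
  ultimately show thesis using that[of "d \<otimes> inv u" "u \<otimes> b0" e c0] e by blast
qed

section \<open>Irreducible and primitive elements under localization\<close>

lemma primitive_rel_module_frac_iff:
  assumes x: "S_reduced R M S x" "x \<noteq> \<zero>\<^bsub>M\<^esub>" and y: "S_reduced R M S y" "y \<noteq> \<zero>\<^bsub>M\<^esub>"
    and S: "d \<in> S" "s \<in> S" "e \<in> S" "t \<in> S"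
  shows "primitive_rel \<rho> (loc_ring R S) (loc_module R M S) (loc_set R S S')
      (frac (d \<odot>\<^bsub>M\<^esub> x) s) (frac (e \<odot>\<^bsub>M\<^esub> y) t) \<longleftrightarrow> primitive_rel \<rho> R M S' x y"
  by (rule primitive_rel_frac_iff[OF saturated' S_subset x y(1) _ _ S])
    (rule smult_split[OF x y(1)] smult_split[OF y x(1)]; assumption)+

lemma saturated_carrier: "saturated_mult_closed R (carrier R)"
  unfolding saturated_mult_closed_def by (auto intro!: submonoid.intro)

lemma irreducible_rel_frac_iff:
  assumes a: "reduced_coeff a" and b: "reduced_coeff b"
    and S: "d \<in> S" "s \<in> S" "e \<in> S" "t \<in> S"
  shows "irreducible_rel \<alpha> (loc_ring R S) (rfrac (d \<otimes> a) s) (rfrac (e \<otimes> b) t) \<longleftrightarrow>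
    irreducible_rel \<alpha> R a b"
proof -
  \<comment> \<open>Needed since \<open>irreducible_rel\<close> views the localized ring as a module
    over itself, not as the localization of a module.\<close>
  have cong: "primitive_rel \<rho> (loc_ring R S) (ring_module (loc_ring R S)) =
      primitive_rel \<rho> (loc_ring R S) (loc_module R (ring_module R) S)" for \<rho>
    by (intro ext, intro primitive_rel_cong[THEN fun_cong, THEN fun_cong])
      (simp_all add: loc_ring_conv)
  have a0: "a \<noteq> \<zero>\<^bsub>ring_module R\<^esub>" using a by (auto simp: annihilator_def)
  show ?thesis
    unfolding irreducible_rel_conv cong loc_ring_carrier
    using regular_module.primitive_rel_frac_iff[OF regular_ring_module saturated_carrier, of a b,
        OF _ _ a0 _ _ _ S] mult_split[OF a b] mult_split[OF b a] a b
    by auto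
qed

text \<open>Factorizations of \<open>a\<close> and of \<open>(d a) / s\<close> correspond: upwards
  by giving \<open>d / s\<close> to one factor, downwards by \<open>mult_decomposition\<close>. The
  relations agree on corresponding factors.\<close>

lemma irreducible_of_frac_iff:
  assumes a: "reduced_coeff a" and S: "d \<in> S" "s \<in> S"
  shows "irreducible_of \<alpha> (loc_ring R S) (rfrac (d \<otimes> a) s) \<longleftrightarrow> irreducible_of \<alpha> R a"
proof -
  let ?L = "loc_ring R S"
  have ac: "a \<in> carrier R" using a by blast
  have carr: "rfrac b t \<in> carrier ?L" if "b \<in> carrier R" "t \<in> S" for b t
    unfolding loc_ring_carrier loc_set_eq using that by blast
  have unit: "rfrac (d \<otimes> a) s \<in> Units ?L \<longleftrightarrow> a \<in> Units R"
    using reduced_coeff_in_S[OF a] S ac by (simp add: rfrac_Units_iff S_mult_iff)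
  have "(\<forall>B \<in> carrier ?L. \<forall>C \<in> carrier ?L. rfrac (d \<otimes> a) s = B \<otimes>\<^bsub>?L\<^esub> C \<longrightarrow>
        irreducible_rel \<alpha> ?L (rfrac (d \<otimes> a) s) B \<or> irreducible_rel \<alpha> ?L (rfrac (d \<otimes> a) s) C) \<longleftrightarrow>
      (\<forall>b \<in> carrier R. \<forall>c \<in> carrier R. a = b \<otimes> c \<longrightarrow>
        irreducible_rel \<alpha> R a b \<or> irreducible_rel \<alpha> R a c)" (is "?l \<longleftrightarrow> ?r")
  proof
    assume l: ?l
    show ?r
    proof (intro ballI impI)
      fix b c assume bc: "b \<in> carrier R" "c \<in> carrier R" and eq: "a = b \<otimes> c"
      have b: "reduced_coeff b" using reduced_coeff_factor a bc unfolding eq by blast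
      have c: "reduced_coeff c"
        using reduced_coeff_factor[of c b] a bc unfolding eq R.m_comm[OF bc] by blast
      \<comment> \<open>The fraction \<open>d / s\<close> goes to \<open>b\<close>; the trivial
        factors at \<open>c\<close> fit the shape of
        \<open>irreducible_rel_frac_iff\<close>.\<close>
      have "rfrac (d \<otimes> a) s = rfrac (d \<otimes> b) s \<otimes>\<^bsub>?L\<^esub> rfrac (\<one> \<otimes> c) \<one>"
        unfolding eq using bc S by (simp add: mult_rfrac R.m_assoc)
      then have "irreducible_rel \<alpha> ?L (rfrac (d \<otimes> a) s) (rfrac (d \<otimes> b) s) \<or>
          irreducible_rel \<alpha> ?L (rfrac (d \<otimes> a) s) (rfrac (\<one> \<otimes> c) \<one>)"
        using l carr[of "d \<otimes> b" s] carr[of "\<one> \<otimes> c" \<one>] bc S by blast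
      then show "irreducible_rel \<alpha> R a b \<or> irreducible_rel \<alpha> R a c"
        unfolding irreducible_rel_frac_iff[OF a b S S] irreducible_rel_frac_iff[OF a c S S_one S_one] .
    qed
  next
    assume r: ?r
    show ?l
    proof (intro ballI impI)
      fix B C assume "B \<in> carrier ?L" "C \<in> carrier ?L" and eq: "rfrac (d \<otimes> a) s = B \<otimes>\<^bsub>?L\<^esub> C"
      then obtain b t c q where b: "b \<in> carrier R" "t \<in> S" "B = rfrac b t"
        and c: "c \<in> carrier R" "q \<in> S" "C = rfrac c q"
        unfolding loc_ring_carrier loc_set_eq by blast
      have "(t \<otimes> q) \<otimes> (d \<otimes> a) = s \<otimes> (b \<otimes> c)"
        using eq b(1,2) c(1,2) S ac unfolding b(3) c(3) by (simp add: mult_rfrac rfrac_eq_iff)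
      then have "(t \<otimes> q \<otimes> d) \<otimes> a = s \<otimes> (b \<otimes> c)"
        using b(2) c(2) S ac by (simp add: R.m_assoc)
      then obtain e b' e' c' where b': "e \<in> S" "reduced_coeff b'" and c': "e' \<in> S" "reduced_coeff c'"
        and eqs: "b = e \<otimes> b'" "c = e' \<otimes> c'" "a = b' \<otimes> c'"
        by (rule mult_decomposition[OF a S_mult[OF S_mult[OF b(2) c(2)] S(1)] S(2) b(1) c(1)])
      have "irreducible_rel \<alpha> R a b' \<or> irreducible_rel \<alpha> R a c'"
        using r b'(2) c'(2) eqs(3) reduced_coeff_carrier by blast
      then show "irreducible_rel \<alpha> ?L (rfrac (d \<otimes> a) s) B \<or> irreducible_rel \<alpha> ?L (rfrac (d \<otimes> a) s) C"
        unfolding b(3) c(3) eqs(1,2) irreducible_rel_frac_iff[OF a b'(2) S b'(1) b(2)]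
          irreducible_rel_frac_iff[OF a c'(2) S c'(1) c(2)] .
    qed
  qed
  then show ?thesis
    unfolding irreducible_of_def using unit ac carr[of "d \<otimes> a" s] S by simp
qed

text \<open>An equation \<open>x = c z\<close> lifts by placing \<open>d / s\<close> at
  \<open>z\<close>. Conversely, the numerator of \<open>Z\<close> is replaced by its reduced part,
  to which \<open>smult_split\<close> applies.\<close>

lemma S_primitive_of_frac_iff:
  assumes x: "S_reduced R M S x" "x \<noteq> \<zero>\<^bsub>M\<^esub>" and S: "d \<in> S" "s \<in> S"
  shows "S_primitive_of \<beta> (loc_ring R S) (loc_module R M S) (loc_set R S S') (frac (d \<odot>\<^bsub>M\<^esub> x) s) \<longleftrightarrow>
    S_primitive_of \<beta> R M S' x" (is "S_primitive_of \<beta> ?L ?N ?T _ \<longleftrightarrow> _")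
proof -
  have xc: "x \<in> carrier M" using x S_reduced_closed by blast
  have "(\<forall>C \<in> ?T. \<forall>Z \<in> carrier ?N. frac (d \<odot>\<^bsub>M\<^esub> x) s = C \<odot>\<^bsub>?N\<^esub> Z \<longrightarrow>
        primitive_rel \<beta> ?L ?N ?T Z (frac (d \<odot>\<^bsub>M\<^esub> x) s)) \<longleftrightarrow>
      (\<forall>c \<in> S'. \<forall>z \<in> carrier M. x = c \<odot>\<^bsub>M\<^esub> z \<longrightarrow> primitive_rel \<beta> R M S' z x)" (is "?l \<longleftrightarrow> ?r")
  proof
    assume l: ?l
    show ?r
    proof (intro ballI impI)
      fix c z assume c: "c \<in> S'" and z: "z \<in> carrier M" and eq: "x = c \<odot>\<^bsub>M\<^esub> z"
      have zr: "S_reduced R M S z" using S_reduced_factor x(1) c z unfolding eq by blast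
      have z0: "z \<noteq> \<zero>\<^bsub>M\<^esub>" using x(2) c unfolding eq by auto
      have "frac (d \<odot>\<^bsub>M\<^esub> x) s = rfrac c \<one> \<odot>\<^bsub>?N\<^esub> frac (d \<odot>\<^bsub>M\<^esub> z) s"
        unfolding eq using c z S by (simp add: smult_frac smult_assoc1 [symmetric] R.m_comm)
      moreover have "rfrac c \<one> \<in> ?T" unfolding loc_set_eq using c by blast
      moreover have "frac (d \<odot>\<^bsub>M\<^esub> z) s \<in> carrier ?N" using S z by (simp add: fraction_closed)
      ultimately have "primitive_rel \<beta> ?L ?N ?T (frac (d \<odot>\<^bsub>M\<^esub> z) s) (frac (d \<odot>\<^bsub>M\<^esub> x) s)"
        using l by blast
      then show "primitive_rel \<beta> R M S' z x"
        unfolding primitive_rel_module_frac_iff[OF zr z0 x S S] .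
    qed
  next
    assume r: ?r
    show ?l
    proof (intro ballI impI)
      fix C Z assume "C \<in> ?T" "Z \<in> carrier ?N" and eq: "frac (d \<odot>\<^bsub>M\<^esub> x) s = C \<odot>\<^bsub>?N\<^esub> Z"
      then obtain c v z t where c: "c \<in> S'" "v \<in> S" "C = rfrac c v"
        and z: "z \<in> carrier M" "t \<in> S" "Z = frac z t"
        unfolding loc_set_eq loc_module_carrier by blast
      have eq1: "(v \<otimes> t \<otimes> d) \<odot>\<^bsub>M\<^esub> x = (s \<otimes> c) \<odot>\<^bsub>M\<^esub> z"
        using eq c(1,2) z(1,2) S xc unfolding c(3) z(3)
        by (simp add: smult_frac frac_eq_iff smult_assoc1)
      have vtd: "v \<otimes> t \<otimes> d \<in> S" using c(2) z(2) S by simp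
      have "(v \<otimes> t \<otimes> d) \<odot>\<^bsub>M\<^esub> x \<noteq> \<zero>\<^bsub>M\<^esub>"
        using x(2) xc vtd by (simp add: smult_eq_zero_iff)
      then have "z \<noteq> \<zero>\<^bsub>M\<^esub>" unfolding eq1 using S c(1) by auto
      then obtain e y where y: "e \<in> S" "S_reduced R M S y" "y \<noteq> \<zero>\<^bsub>M\<^esub>" "z = e \<odot>\<^bsub>M\<^esub> y"
        using S_reduced_decomposition[OF z(1)] by blast
      have yc: "y \<in> carrier M" using y(2) by (rule S_reduced_closed)
      have "(v \<otimes> t \<otimes> d) \<odot>\<^bsub>M\<^esub> x = (s \<otimes> c \<otimes> e) \<odot>\<^bsub>M\<^esub> y"
        unfolding eq1 y(4) using S c(1) y(1) yc by (simp add: smult_assoc1)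
      moreover have "s \<otimes> c \<otimes> e \<in> S'" using S c(1) y(1) S_imp_S' by simp
      ultimately obtain c' where "c' \<in> S'" "x = c' \<odot>\<^bsub>M\<^esub> y"
        using smult_split[OF x y(2) vtd] by blast
      then have "primitive_rel \<beta> R M S' y x" using r yc by blast
      then show "primitive_rel \<beta> ?L ?N ?T Z (frac (d \<odot>\<^bsub>M\<^esub> x) s)"
        unfolding z(3) y(4) primitive_rel_module_frac_iff[OF y(2,3) x y(1) z(2) S] .
    qed
  qed
  then show ?thesis
    unfolding S_primitive_of_def using xc S by (simp add: fraction_closed)
qed

section \<open>Factorizations under localization\<close>

text \<open>The factor \<open>\<one>\<close> in the numerators gives them the shape \<open>d \<otimes> r\<close> of
  \<open>irreducible_of_frac_iff\<close>.\<close>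

lemma foldr_rfrac_smult:
  assumes "set rs \<subseteq> carrier R" "x \<in> carrier M" "t \<in> S"
  shows "foldr (\<otimes>\<^bsub>loc_ring R S\<^esub>) (map (\<lambda>r. rfrac (\<one> \<otimes> r) \<one>) rs) \<one>\<^bsub>loc_ring R S\<^esub>
      \<odot>\<^bsub>loc_module R M S\<^esub> frac x t = frac (foldr (\<otimes>) rs \<one> \<odot>\<^bsub>M\<^esub> x) t"
  using assms(1)
proof (induction rs)
  interpret L: module "loc_ring R S" "loc_module R M S"
    by (rule loc_module_module[OF submonoid_S])
  case Nil
  have "frac x t \<in> carrier (loc_module R M S)" using assms by (simp add: fraction_closed)
  then show ?case using assms by simp
next
  interpret L: module "loc_ring R S" "loc_module R M S"
    by (rule loc_module_module[OF submonoid_S])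
  case (Cons r rs)
  have carr: "rfrac (\<one> \<otimes> a) \<one> \<in> carrier (loc_ring R S)" if "a \<in> carrier R" for a
    unfolding loc_ring_carrier loc_set_eq using that by auto
  have "frac x t \<in> carrier (loc_module R M S)" using assms by (simp add: fraction_closed)
  moreover have "set (map (\<lambda>r. rfrac (\<one> \<otimes> r) \<one>) rs) \<subseteq> carrier (loc_ring R S)"
    using Cons.prems carr by auto
  moreover have "rfrac (\<one> \<otimes> r) \<one> \<in> carrier (loc_ring R S)" using Cons.prems carr by auto
  ultimately have "foldr (\<otimes>\<^bsub>loc_ring R S\<^esub>) (map (\<lambda>r. rfrac (\<one> \<otimes> r) \<one>) (r # rs)) \<one>\<^bsub>loc_ring R S\<^esub>
      \<odot>\<^bsub>loc_module R M S\<^esub> frac x t =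
      rfrac (\<one> \<otimes> r) \<one> \<odot>\<^bsub>loc_module R M S\<^esub> frac (foldr (\<otimes>) rs \<one> \<odot>\<^bsub>M\<^esub> x) t"
    using Cons.IH Cons.prems
    by (simp only: list.map L.foldr_mult_Cons_smult) simp
  also have "\<dots> = frac (foldr (\<otimes>) (r # rs) \<one> \<odot>\<^bsub>M\<^esub> x) t"
    using Cons.prems assms by (simp add: smult_frac smult_assoc1)
  finally show ?case .
qed

text \<open>The factors in \<open>S\<close> become units and move into the numerator of the
  primitive part. The reduced ones stay irreducible, and \<open>y\<close> stays primitive by the
  transfer results.\<close>

lemma loc_atomic_of_S'_atomic:
  assumes "S_atomic \<alpha> \<beta> R M S'"
  shows "S_atomic \<alpha> \<beta> (loc_ring R S) (loc_module R M S) (loc_set R S S')"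
  unfolding S_atomic_def
proof (intro ballI impI)
  let ?L = "loc_ring R S" and ?N = "loc_module R M S"
  fix X assume "X \<in> carrier ?N" and X0: "X \<noteq> \<zero>\<^bsub>?N\<^esub>"
  then obtain x s where x: "x \<in> carrier M" "s \<in> S" "X = frac x s"
    unfolding loc_module_carrier by blast
  have x0: "x \<noteq> \<zero>\<^bsub>M\<^esub>" using X0 x(1,2) unfolding x(3) by (simp add: frac_zero_iff)
  obtain as y where f: "S_factorization \<alpha> \<beta> R M S' x as y"
    using assms x(1) x0 unfolding S_atomic_def by blast
  obtain ss rs where ss: "set ss \<subseteq> set as \<inter> S"
    and rs: "set rs \<subseteq> {r \<in> set as. r \<notin> S \<and> r \<notin> annihilator R M \<and> S_reduced R (ring_module R) S r}"
    and eq: "x = foldr (\<otimes>) ss \<one> \<odot>\<^bsub>M\<^esub> (foldr (\<otimes>) rs \<one> \<odot>\<^bsub>M\<^esub> y)"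
    and y: "S_reduced R M S y"
    by (rule S_factorization_split[OF f x0])
  have as: "\<And>a. a \<in> set as \<Longrightarrow> a \<in> S' \<and> irreducible_of \<alpha> R a" and yp: "S_primitive_of \<beta> R M S' y"
    using f unfolding S_factorization_def by blast+
  let ?e = "foldr (\<otimes>) ss \<one>" and ?rs = "map (\<lambda>r. rfrac (\<one> \<otimes> r) \<one>) rs"
  have e: "?e \<in> S" using ss by (intro foldr_mult_in_S) blast
  have yc: "y \<in> carrier M" using y by (rule S_reduced_closed)
  have rsc: "set rs \<subseteq> carrier R" using rs as by blast
  have y0: "y \<noteq> \<zero>\<^bsub>M\<^esub>" using x0 e rsc unfolding eq by auto
  have "S_factorization \<alpha> \<beta> ?L ?N (loc_set R S S') X ?rs (frac (?e \<odot>\<^bsub>M\<^esub> y) s)"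
    unfolding S_factorization_def
  proof (intro conjI ballI)
    fix A assume "A \<in> set ?rs"
    then obtain r where r: "r \<in> set rs" "A = rfrac (\<one> \<otimes> r) \<one>" by auto
    have red: "reduced_coeff r" and irr: "irreducible_of \<alpha> R r" using r(1) rs as by blast+
    have rc: "r \<in> carrier R" using red by blast
    show "A \<in> loc_set R S S'" unfolding r(2) loc_set_eq using red rc by auto
    show "irreducible_of \<alpha> ?L A"
      unfolding r(2) irreducible_of_frac_iff[OF red S_one S_one] by (rule irr)
    then show "A \<notin> Units ?L" unfolding irreducible_of_def by blast
  next
    show "S_primitive_of \<beta> ?L ?N (loc_set R S S') (frac (?e \<odot>\<^bsub>M\<^esub> y) s)"
      unfolding S_primitive_of_frac_iff[OF y y0 e x(2)] by (rule yp)
    \<comment> \<open>The \<open>S\<close>-part is now attached to \<open>y\<close>, whereas the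
      split produced it as the outer coefficient.\<close>
    have "x = foldr (\<otimes>) rs \<one> \<odot>\<^bsub>M\<^esub> (?e \<odot>\<^bsub>M\<^esub> y)"
      unfolding eq using e rsc yc by (simp add: smult_assoc1 [symmetric] R.m_comm)
    then show "X = foldr (\<otimes>\<^bsub>?L\<^esub>) ?rs \<one>\<^bsub>?L\<^esub> \<odot>\<^bsub>?N\<^esub> frac (?e \<odot>\<^bsub>M\<^esub> y) s"
      using foldr_rfrac_smult[OF rsc _ x(2), of "?e \<odot>\<^bsub>M\<^esub> y"] e yc unfolding x(3) by simp
  qed
  then show "\<exists>As Y. S_factorization \<alpha> \<beta> ?L ?N (loc_set R S S') X As Y" by blast
qed

text \<open>Induction on the factors. Each \<open>A\<close> is \<open>(d' r) / v\<close> with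
  \<open>r\<close> a reduced coefficient, irreducible by transfer; \<open>d'\<close> and
  \<open>v\<close> join the accumulated numerator and denominator. The nonzero product again ensures
  that reducedness persists.\<close>

lemma clear_denominators:
  assumes y: "S_reduced R M S y" and S: "e \<in> S" "t \<in> S"
    and "\<And>A. A \<in> set As \<Longrightarrow> A \<in> loc_set R S S' \<and> irreducible_of \<alpha> (loc_ring R S) A"
    and "foldr (\<otimes>\<^bsub>loc_ring R S\<^esub>) As \<one>\<^bsub>loc_ring R S\<^esub> \<odot>\<^bsub>loc_module R M S\<^esub> frac (e \<odot>\<^bsub>M\<^esub> y) t \<noteq>
      \<zero>\<^bsub>loc_module R M S\<^esub>"
  shows "\<exists>rs d s. set rs \<subseteq> {r. reduced_coeff r \<and> irreducible_of \<alpha> R r} \<and> d \<in> S \<and> s \<in> S \<and>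
    foldr (\<otimes>\<^bsub>loc_ring R S\<^esub>) As \<one>\<^bsub>loc_ring R S\<^esub> \<odot>\<^bsub>loc_module R M S\<^esub> frac (e \<odot>\<^bsub>M\<^esub> y) t =
      frac (d \<odot>\<^bsub>M\<^esub> (foldr (\<otimes>) rs \<one> \<odot>\<^bsub>M\<^esub> y)) s \<and>
    S_reduced R M S (foldr (\<otimes>) rs \<one> \<odot>\<^bsub>M\<^esub> y)"
  using assms(4,5)
proof (induction As)
  interpret L: module "loc_ring R S" "loc_module R M S"
    by (rule loc_module_module[OF submonoid_S])
  case Nil
  have yc: "y \<in> carrier M" using y by (rule S_reduced_closed)
  then have "frac (e \<odot>\<^bsub>M\<^esub> y) t \<in> carrier (loc_module R M S)" using S by (simp add: fraction_closed)
  then show ?case using S y yc by (intro exI[of _ "[]"] exI[of _ e] exI[of _ t]) simp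
next
  interpret L: module "loc_ring R S" "loc_module R M S"
    by (rule loc_module_module[OF submonoid_S])
  case (Cons A As)
  let ?L = "loc_ring R S" and ?N = "loc_module R M S"
  let ?P = "\<lambda>As. foldr (\<otimes>\<^bsub>?L\<^esub>) As \<one>\<^bsub>?L\<^esub> \<odot>\<^bsub>?N\<^esub> frac (e \<odot>\<^bsub>M\<^esub> y) t"
  have yc: "y \<in> carrier M" using y by (rule S_reduced_closed)
  then have Yc: "frac (e \<odot>\<^bsub>M\<^esub> y) t \<in> carrier ?N" using S by (simp add: fraction_closed)
  have TL: "loc_set R S S' \<subseteq> carrier ?L" unfolding loc_ring_carrier loc_set_eq by blast
  have A: "A \<in> loc_set R S S'" "irreducible_of \<alpha> ?L A" using Cons.prems(1) by auto
  have As: "B \<in> loc_set R S S' \<and> irreducible_of \<alpha> ?L B" if "B \<in> set As" for B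
    using Cons.prems(1) that by simp
  have Ac: "A \<in> carrier ?L" "set As \<subseteq> carrier ?L" using A As TL by blast+
  have step: "?P (A # As) = A \<odot>\<^bsub>?N\<^esub> ?P As" by (rule L.foldr_mult_Cons_smult[OF Ac Yc])
  have nz: "?P As \<noteq> \<zero>\<^bsub>?N\<^esub>"
  proof
    assume "?P As = \<zero>\<^bsub>?N\<^esub>"
    then show False using Cons.prems(2) Ac(1) unfolding step by simp
  qed
  from Cons.IH[OF As nz] obtain rs d s where
    rs: "set rs \<subseteq> {r. reduced_coeff r \<and> irreducible_of \<alpha> R r}" and ds: "d \<in> S" "s \<in> S"
    and eq: "?P As = frac (d \<odot>\<^bsub>M\<^esub> (foldr (\<otimes>) rs \<one> \<odot>\<^bsub>M\<^esub> y)) s"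
    and red: "S_reduced R M S (foldr (\<otimes>) rs \<one> \<odot>\<^bsub>M\<^esub> y)" by blast
  let ?z = "foldr (\<otimes>) rs \<one> \<odot>\<^bsub>M\<^esub> y"
  have zc: "?z \<in> carrier M" using red by (rule S_reduced_closed)
  have rsc: "set rs \<subseteq> carrier R" using rs by blast
  obtain a v where a: "a \<in> S'" "v \<in> S" "A = rfrac a v" using A(1) unfolding loc_set_eq by blast
  have "A \<odot>\<^bsub>?N\<^esub> ?P As = frac (a \<odot>\<^bsub>M\<^esub> (d \<odot>\<^bsub>M\<^esub> ?z)) (v \<otimes> s)"
    unfolding eq a(3) using a(1,2) ds zc by (simp add: smult_frac)
  with step have eq1: "?P (A # As) = frac (a \<odot>\<^bsub>M\<^esub> (d \<odot>\<^bsub>M\<^esub> ?z)) (v \<otimes> s)"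
    by (rule trans)
  then have az: "a \<odot>\<^bsub>M\<^esub> (d \<odot>\<^bsub>M\<^esub> ?z) \<noteq> \<zero>\<^bsub>M\<^esub>"
    using Cons.prems(2) a(1,2) ds zc by (simp add: frac_zero_iff del: foldr.simps)
  then have ann: "a \<notin> annihilator R M"
    using not_annihilator[of a "d \<odot>\<^bsub>M\<^esub> ?z"] a(1) ds(1) zc by blast
  obtain d' r where r: "d' \<in> S" "r \<in> S'" "r \<notin> annihilator R M"
    "S_reduced R (ring_module R) S r" "a = d' \<otimes> r"
    by (rule ring_S_reduced_decomposition[OF a(1) ann])
  have rr: "reduced_coeff r" using r by blast
  have irr: "irreducible_of \<alpha> R r"
    using A(2) unfolding a(3) r(5) irreducible_of_frac_iff[OF rr r(1) a(2)] .
  have "a \<odot>\<^bsub>M\<^esub> (d \<odot>\<^bsub>M\<^esub> ?z) = (d' \<otimes> d) \<odot>\<^bsub>M\<^esub> (r \<odot>\<^bsub>M\<^esub> ?z)"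
    unfolding r(5) using r(1,2) ds(1) zc by (simp add: smult_assoc1 [symmetric] R.m_ac del: smult_closed)
  moreover have rz: "foldr (\<otimes>) (r # rs) \<one> \<odot>\<^bsub>M\<^esub> y = r \<odot>\<^bsub>M\<^esub> ?z"
    using r(2) rsc yc by (intro foldr_mult_Cons_smult) auto
  ultimately have adz: "a \<odot>\<^bsub>M\<^esub> (d \<odot>\<^bsub>M\<^esub> ?z) = (d' \<otimes> d) \<odot>\<^bsub>M\<^esub> (foldr (\<otimes>) (r # rs) \<one> \<odot>\<^bsub>M\<^esub> y)"
    by metis
  then have "r \<odot>\<^bsub>M\<^esub> ?z \<noteq> \<zero>\<^bsub>M\<^esub>" using az r(1) ds(1) unfolding rz by auto
  then have "S_reduced R M S (foldr (\<otimes>) (r # rs) \<one> \<odot>\<^bsub>M\<^esub> y)"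
    unfolding rz by (rule S_reduced_smult[OF r(4) red])
  moreover have "set (r # rs) \<subseteq> {r. reduced_coeff r \<and> irreducible_of \<alpha> R r}"
    using rs rr irr by simp
  moreover have "d' \<otimes> d \<in> S" "v \<otimes> s \<in> S" using r(1) ds a(2) by simp_all
  ultimately show ?case using eq1 [unfolded adz] by blast
qed

text \<open>An \<open>S\<close>-factorization of \<open>x\<close> isolates a reduced
  \<open>n\<close>. A factorization of \<open>n / 1\<close> in the localization, cleared of
  denominators, determines \<open>n\<close> up to a unit and supplies the remaining factors.\<close>

lemma S'_atomic_of_loc_atomic:
  assumes atomic: "S_atomic \<alpha> \<gamma> R M S"
    and loc_atomic: "S_atomic \<alpha> \<beta> (loc_ring R S) (loc_module R M S) (loc_set R S S')"
  shows "S_atomic \<alpha> \<beta> R M S'"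
  unfolding S_atomic_def
proof (intro ballI impI)
  let ?L = "loc_ring R S" and ?N = "loc_module R M S"
  interpret L: module ?L ?N by (rule loc_module_module[OF submonoid_S])
  fix x assume x: "x \<in> carrier M" "x \<noteq> \<zero>\<^bsub>M\<^esub>"
  obtain ss n where "S_factorization \<alpha> \<gamma> R M S x ss n"
    using atomic x unfolding S_atomic_def by blast
  then have ss: "\<And>s. s \<in> set ss \<Longrightarrow> s \<in> S \<and> s \<notin> Units R \<and> irreducible_of \<alpha> R s"
    and n: "S_primitive_of \<gamma> R M S n" and xn: "x = foldr (\<otimes>) ss \<one> \<odot>\<^bsub>M\<^esub> n"
    unfolding S_factorization_def by blast+
  have ssc: "set ss \<subseteq> carrier R" using ss by blast
  have n0: "n \<noteq> \<zero>\<^bsub>M\<^esub>" using x(2) ssc unfolding xn by auto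
  have nr: "S_reduced R M S n"
    using S_primitive_imp_S_reduced[OF S_primitive_of_imp_S_primitive[OF n] n0] .
  have nc: "n \<in> carrier M" using nr by (rule S_reduced_closed)
  have N: "frac n \<one> \<in> carrier ?N" "frac n \<one> \<noteq> \<zero>\<^bsub>?N\<^esub>"
    using nc n0 by (simp_all add: fraction_closed frac_zero_iff)
  then obtain As Y where "S_factorization \<alpha> \<beta> ?L ?N (loc_set R S S') (frac n \<one>) As Y"
    using loc_atomic unfolding S_atomic_def by blast
  then have As: "\<And>A. A \<in> set As \<Longrightarrow> A \<in> loc_set R S S' \<and> irreducible_of \<alpha> ?L A"
    and Y: "S_primitive_of \<beta> ?L ?N (loc_set R S S') Y"
    and nY: "frac n \<one> = foldr (\<otimes>\<^bsub>?L\<^esub>) As \<one>\<^bsub>?L\<^esub> \<odot>\<^bsub>?N\<^esub> Y"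
    unfolding S_factorization_def by blast+
  have "Y \<in> carrier ?N" using Y unfolding S_primitive_of_def by blast
  then obtain y' t where y': "y' \<in> carrier M" "t \<in> S" "Y = frac y' t"
    unfolding loc_module_carrier by blast
  have "set As \<subseteq> carrier ?L" using As unfolding loc_ring_carrier loc_set_eq by blast
  then have "Y \<noteq> \<zero>\<^bsub>?N\<^esub>" using N(2) unfolding nY by auto
  then have "y' \<noteq> \<zero>\<^bsub>M\<^esub>" using y'(1,2) unfolding y'(3) by (simp add: frac_zero_iff)
  then obtain e y where y: "e \<in> S" "S_reduced R M S y" "y \<noteq> \<zero>\<^bsub>M\<^esub>" "y' = e \<odot>\<^bsub>M\<^esub> y"
    using S_reduced_decomposition[OF y'(1)] by blast
  have yc: "y \<in> carrier M" using y(2) by (rule S_reduced_closed)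
  have Ye: "Y = frac (e \<odot>\<^bsub>M\<^esub> y) t" unfolding y'(3) y(4) ..
  obtain rs d s where rs: "set rs \<subseteq> {r. reduced_coeff r \<and> irreducible_of \<alpha> R r}"
    and ds: "d \<in> S" "s \<in> S" and eq: "frac n \<one> = frac (d \<odot>\<^bsub>M\<^esub> (foldr (\<otimes>) rs \<one> \<odot>\<^bsub>M\<^esub> y)) s"
    and red: "S_reduced R M S (foldr (\<otimes>) rs \<one> \<odot>\<^bsub>M\<^esub> y)"
    using clear_denominators[OF y(2,1) y'(2) As] N(2) unfolding nY Ye by blast
  have rsc: "set rs \<subseteq> carrier R" using rs by blast
  have "s \<odot>\<^bsub>M\<^esub> n = d \<odot>\<^bsub>M\<^esub> (foldr (\<otimes>) rs \<one> \<odot>\<^bsub>M\<^esub> y)"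
    using eq nc ds rsc yc by (simp add: frac_eq_iff)
  then obtain w where w: "w \<in> Units R" "n = w \<odot>\<^bsub>M\<^esub> (foldr (\<otimes>) rs \<one> \<odot>\<^bsub>M\<^esub> y)"
    using S_reduced_unique[OF nr n0 red ds(2,1)] by blast
  have wc: "w \<in> carrier R" "w \<in> S" "inv w \<in> S" using w(1) Units_S R.Units_inv_Units by blast+
  \<comment> \<open>The unit \<open>w\<close> is moved onto \<open>y\<close>, so that no extra
    factor appears in the list.\<close>
  have nw: "n = foldr (\<otimes>) rs \<one> \<odot>\<^bsub>M\<^esub> (w \<odot>\<^bsub>M\<^esub> y)"
    unfolding w(2) using wc rsc yc by (simp add: smult_assoc1 [symmetric] R.m_comm)
  have wy: "S_reduced R M S (w \<odot>\<^bsub>M\<^esub> y)" using S_reduced_unit[OF y(2) w(1)] .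
  have wy0: "w \<odot>\<^bsub>M\<^esub> y \<noteq> \<zero>\<^bsub>M\<^esub>" using n0 rsc unfolding nw by auto
  \<comment> \<open>Rewriting \<open>e y\<close> as an \<open>S\<close>-multiple of
    \<open>w y\<close> lets primitivity of \<open>Y\<close> be transferred to \<open>w y\<close>
    itself.\<close>
  have "(e \<otimes> inv w) \<odot>\<^bsub>M\<^esub> (w \<odot>\<^bsub>M\<^esub> y) = e \<odot>\<^bsub>M\<^esub> ((inv w \<otimes> w) \<odot>\<^bsub>M\<^esub> y)"
    using wc y(1) yc by (simp add: smult_assoc1)
  then have "(e \<otimes> inv w) \<odot>\<^bsub>M\<^esub> (w \<odot>\<^bsub>M\<^esub> y) = e \<odot>\<^bsub>M\<^esub> y" using w(1) yc by simp
  then have "S_primitive_of \<beta> R M S' (w \<odot>\<^bsub>M\<^esub> y)"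
    using S_primitive_of_frac_iff[OF wy wy0 S_mult[OF y(1) wc(3)] y'(2)] Y unfolding Ye by simp
  moreover have "x = foldr (\<otimes>) (ss @ rs) \<one> \<odot>\<^bsub>M\<^esub> (w \<odot>\<^bsub>M\<^esub> y)"
    unfolding xn foldr_mult_append[OF ssc rsc]
    by (subst nw) (use ssc rsc wc yc in \<open>simp add: smult_assoc1\<close>)
  moreover have "a \<in> S' \<and> a \<notin> Units R \<and> irreducible_of \<alpha> R a" if "a \<in> set (ss @ rs)" for a
  proof (cases "a \<in> set ss")
    case True
    then show ?thesis using ss[of a] S_imp_S' by blast
  next
    case False
    then have "reduced_coeff a \<and> irreducible_of \<alpha> R a" using that rs by auto
    then show ?thesis unfolding irreducible_of_def by blast
  qed
  ultimately have "S_factorization \<alpha> \<beta> R M S' x (ss @ rs) (w \<odot>\<^bsub>M\<^esub> y)"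
    unfolding S_factorization_def by blast
  then show "\<exists>as y. S_factorization \<alpha> \<beta> R M S' x as y" by blast
qed

end

theorem theorem4p4:
  fixes R :: "('a, 'm) ring_scheme" and M :: "('a, 'b, 'n) module_scheme"
    and S S' :: "'a set" and T :: "('a \<times> 'a) set set"
    and \<alpha> :: irreducible_type and \<beta> :: primitive_type
  assumes "module R M" and "carrier M \<noteq> {\<zero>\<^bsub>M\<^esub>}"
    and "saturated_mult_closed R S" and "saturated_mult_closed R S'" and "S \<subseteq> S'"
    and "T = loc_set R S S'"
    and "splits R M S (carrier M)"
    and "compactly_S_atomic R (ring_module R) S (S' - annihilator R M)"
  shows "(S_atomic \<alpha> \<beta> R M S' \<longrightarrow> S_atomic \<alpha> Very_Strongly_Primitive R M S) \<and>
    (S \<inter> zero_divs R M = {} \<and> S \<inter> zero_divs R (ring_module R) = {} \<longrightarrow>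
      (S_atomic \<alpha> \<beta> R M S' \<longleftrightarrow>
        S_atomic \<alpha> Primitive R M S \<and> S_atomic \<alpha> \<beta> (loc_ring R S) (loc_module R M S) T))"
proof -
  interpret split_module R M S S'
    by (intro split_module.intro split_module_axioms.intro saturated_module.intro
        saturated_module_axioms.intro assms)
  have "S_atomic \<alpha> \<beta> R M S' \<longleftrightarrow>
      S_atomic \<alpha> Primitive R M S \<and> S_atomic \<alpha> \<beta> (loc_ring R S) (loc_module R M S) T"
    if "S \<inter> zero_divs R M = {}" "S \<inter> zero_divs R (ring_module R) = {}"
  proof -
    \<comment> \<open>Regularity is a hypothesis of (2) alone, so the finer locale is entered only
      here.\<close>
    interpret regular_split_module R M S S'
      by (intro regular_split_module.intro split_module_axioms regular_module.intro
          saturated_module_axioms regular_module_axioms.intro that)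
    show ?thesis
      unfolding assms(6)
      using S_atomic_of_S'_atomic loc_atomic_of_S'_atomic S'_atomic_of_loc_atomic by blast
  qed
  then show ?thesis using S_atomic_of_S'_atomic by blast
qed

end
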